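(* Let $n>6$ be an integer. Let $h$ be the unique integer with $5\cdot2^{h-1}+1<n\le5\cdot2^h+1$, and let $m$ be the nearest integer to $(n+1)/5$, so that $n\in\{5m-3,5m-2,5m-1,5m,5m+1\}$ (one has $m>2^{h-1}$). Construct a plane rooted tree $T_n$ as follows: start from the complete binary tree of height $h-1$ (every non-leaf has exactly two children and all $2^{h-1}$ leaves are at level $h-1$); replace each of the $m-2^{h-1}$ leftmost leaves by a copy of $[[\bullet,\bullet,\bullet],[\bullet,\bullet,\bullet]]$ (i.e., give it two children and give each of these three children); replace each of the remaining $2^h-m$ leaves by a copy of $[\bullet,\bullet,\bullet]$ (give it three children). The result has $5m-1$ vertices. Then: if $n=5m-1$ stop; if $n=5m-2$, remove the last leaf in the canonical order; if $n=5m-3$, remove one leaf child from each of the last two vertices in the canonical order that have leaf children; if $n=5m$, add one leaf child to the first vertex in the canonical order that has leaf children; if $n=5m+1$, add one leaf child to each of the first two vertices in the canonical order that have leaf children. Then $T_n$ is a minimal tree of order $n$. If $n\not\equiv2\pmod5$, then $T_n$ is (up to isomorphism of rooted trees) the only minimal tree of order $n$. If $n\equiv2\pmod5$, then $T_n$ contains exactly one branch isomorphic to $[[\bullet,\bullet],[\bullet,\bullet]]$, and the minimal trees of order $n$ are exactly $T_n$ and the tree obtained from $T_n$ by replacing this branch by $[[\bullet,\bullet,\bullet],\bullet,\bullet]$.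
   Context: A rooted tree $T$ is a finite tree with a distinguished vertex, its root; its order $|T|$ is its number of vertices; the $i$-th level consists of the vertices at distance $i$ from the root. For vertices $u,v$, the infimum of $u$ and $v$ is the vertex common to the path from $u$ to the root and the path from $v$ to the root that is furthest from the root. A set $X\subseteq V(T)$ is infima closed if the infimum of any two elements of $X$ lies in $X$. $I(T)$ denotes the number of nonempty infima closed subsets of $V(T)$. For $n\ge1$, $m_n=\min\{I(T): |T|=n\}$; a rooted tree $T$ with $I(T)=m_{|T|}$ is called minimal. A branch of $T$ is the subtree consisting of a vertex and all its descendants. $[B_1,\dots,B_k]$ denotes the rooted tree whose root has exactly $k$ children with branches $B_1,\dots,B_k$, and $\bullet$ denotes the one-vertex tree. For a rooted tree embedded in the plane (children ordered left to right), the canonical order of vertices orders them first by level (lower level first) and, within a level, from left to right. *)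

theory Defs
  imports Complex_Main "HOL-Combinatorics.Permutations" "HOL-Library.List_Lexorder" "HOL-Library.Product_Lexorder"
begin

datatype tree = Node "tree list"

primrec kids :: "tree \<Rightarrow> tree list" where
  "kids (Node ts) = ts"

definition leaf :: tree where "leaf = Node []"

text \<open>Vertices are addressed by paths (lists of child indices) from the root.\<close>
primrec valid :: "tree \<Rightarrow> nat list \<Rightarrow> bool" where
  "valid t [] = True"
| "valid t (i # p) = (i < length (kids t) \<and> valid (kids t ! i) p)"

definition pos :: "tree \<Rightarrow> nat list set" where
  "pos t = {p. valid t p}"

definition order :: "tree \<Rightarrow> nat" where
  "order t = card (pos t)"

primrec sub :: "tree \<Rightarrow> nat list \<Rightarrow> tree" where
  "sub t [] = t"
| "sub t (i # p) = sub (kids t ! i) p"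

primrec upd_at :: "nat list \<Rightarrow> (tree \<Rightarrow> tree) \<Rightarrow> tree \<Rightarrow> tree" where
  "upd_at [] f t = f t"
| "upd_at (i # p) f t = Node ((kids t)[i := upd_at p f (kids t ! i)])"

text \<open>Infimum of two vertices = longest common prefix of their paths.\<close>
fun lcp :: "nat list \<Rightarrow> nat list \<Rightarrow> nat list" where
  "lcp (a # p) (b # q) = (if a = b then a # lcp p q else [])"
| "lcp _ _ = []"

definition infima_closed :: "nat list set \<Rightarrow> bool" where
  "infima_closed X = (\<forall>u\<in>X. \<forall>v\<in>X. lcp u v \<in> X)"

definition I :: "tree \<Rightarrow> nat" where
  "I t = card {X. X \<subseteq> pos t \<and> X \<noteq> {} \<and> infima_closed X}"

definition mn :: "nat \<Rightarrow> nat" where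
  "mn n = Min {I T | T. order T = n}"

definition minimal :: "tree \<Rightarrow> bool" where
  "minimal T = (I T = mn (order T))"

inductive iso :: "tree \<Rightarrow> tree \<Rightarrow> bool" where
  "length ts = length us \<Longrightarrow> \<pi> permutes {..<length ts} \<Longrightarrow>
   (\<forall>i<length ts. iso (ts ! i) (us ! \<pi> i)) \<Longrightarrow> iso (Node ts) (Node us)"

text \<open>Canonical order: by level, then left to right (= lexicographic on paths of equal length).\<close>
definition vlist :: "tree \<Rightarrow> nat list list" where
  "vlist t = map snd (sorted_list_of_set ((\<lambda>p. (length p, p)) ` pos t))"

definition has_leaf_child :: "tree \<Rightarrow> nat list \<Rightarrow> bool" where
  "has_leaf_child t p = (leaf \<in> set (kids (sub t p)))"

definition leaves_c :: "tree \<Rightarrow> nat list list" where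
  "leaves_c t = filter (\<lambda>p. kids (sub t p) = []) (vlist t)"

definition hlc :: "tree \<Rightarrow> nat list list" where
  "hlc t = filter (has_leaf_child t) (vlist t)"

definition del_leaf :: "tree \<Rightarrow> tree" where
  "del_leaf s = (let ts = kids s; j = last (filter (\<lambda>j. ts ! j = leaf) [0..<length ts])
                 in Node (take j ts @ drop (Suc j) ts))"

definition add_leaf :: "tree \<Rightarrow> tree" where
  "add_leaf s = Node (kids s @ [leaf])"

definition remove_leaf_at :: "nat list \<Rightarrow> tree \<Rightarrow> tree" where
  "remove_leaf_at q t = upd_at (butlast q)
      (\<lambda>s. Node (take (last q) (kids s) @ drop (Suc (last q)) (kids s))) t"

definition star3 :: tree where "star3 = Node [leaf, leaf, leaf]"
definition B2 :: tree where "B2 = Node [star3, star3]"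
definition B4 :: tree where "B4 = Node [Node [leaf, leaf], Node [leaf, leaf]]"
definition B4' :: tree where "B4' = Node [star3, leaf, leaf]"

text \<open>Complete binary tree of height k whose 2^k leaves (left to right) are replaced by ts.\<close>
primrec cbt :: "nat \<Rightarrow> tree list \<Rightarrow> tree" where
  "cbt 0 ts = hd ts"
| "cbt (Suc k) ts = Node [cbt k (take (2 ^ k) ts), cbt k (drop (2 ^ k) ts)]"

definition h_of :: "nat \<Rightarrow> nat" where
  "h_of n = (THE h. 5 * 2 ^ (h - 1) + 1 < n \<and> n \<le> 5 * 2 ^ h + 1)"

definition m_of :: "nat \<Rightarrow> nat" where
  "m_of n = nat (round ((real n + 1) / 5))"

definition base_tree :: "nat \<Rightarrow> tree" where
  "base_tree n = (let h = h_of n; m = m_of n in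
     cbt (h - 1) (replicate (m - 2 ^ (h - 1)) B2 @ replicate (2 ^ h - m) star3))"

definition Tn :: "nat \<Rightarrow> tree" where
  "Tn n = (let m = m_of n; t = base_tree n; L = hlc t in
     if n + 1 = 5 * m then t
     else if n + 2 = 5 * m then remove_leaf_at (last (leaves_c t)) t
     else if n + 3 = 5 * m then
       upd_at (L ! (length L - 2)) del_leaf (upd_at (last L) del_leaf t)
     else if n = 5 * m then upd_at (hd L) add_leaf t
     else upd_at (L ! 1) add_leaf (upd_at (L ! 0) add_leaf t))"

end

theory Submission
  imports Defs
begin

text \<open>
  If $z(T) = I(T) + 2$, then $z([A, B]) = z(A) z(B) - 1$, and a minimal tree of order at least
  seven has a root of degree two, apart from $[[\bullet,\bullet,\bullet],\bullet,\bullet]$.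
  So the minimal values obey $z_n = \min_{a + b = n - 1} z_a z_b - 1$, and everything reduces to
  finding the optimal pairs $(a, b)$. Suppose that an optimal pair $(a, b)$ arises from optimal
  pairs $(a_1, a_2)$ and $(b_1, b_2)$. Regrouping $b$ with some $a_i$, or $a_i$ with $b_j$, and
  splitting the sum optimally must not lower the product; by induction the optimal splittings of
  these smaller sums are known, and the inequalities between the orders which this gives leave
  only one pair. In all but two cases per scale, it contains the order $5 \cdot 2^k - 1$ of a
  complete binary tree with leaves replaced by $[\bullet,\bullet,\bullet]$.
\<close>

subsection \<open>Sequences defined by optimal splittings\<close>

text \<open>The case analysis of the exchanges needs scales large enough to keep the values apart:
  for \<open>P = 4\<close> already \<open>2 * P - 3\<close> and \<open>P + 1\<close> coincide.
  Orders below 40 are therefore settled by evaluating a table.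

  The exceptional splittings come from orders \<open>5 * m + 1\<close>, at the two places where the
  two surplus leaves fall into different halves of the tree.

  Uniqueness of the trees, as opposed to the orders of their halves, depends on residues modulo 5.
  Either one part of a splitting has residue 4, and then the other part has the residue of the
  whole, or both parts are multiples of 5. So residue 2 descends to exactly one part at each step
  until it reaches order 7, where \<open>8 * 8 - 1 = 5 * 13 - 2\<close> makes \<open>B4\<close> and
  \<open>B4'\<close> tie. This tie is met once if the order is 2 modulo 5, and never
  otherwise.\<close>

definition perfect :: "nat \<Rightarrow> bool" where
  "perfect P \<longleftrightarrow> (\<exists>k. P + 1 = 5 * 2 ^ k)"

text \<open>
  The optimal splittings with larger part $a$. The sums handled by a given
  $P$ range from $2P$ to $4P + 2$; the last two lines are the
  exceptional splittings, into which the excluded values of the first two lines turn.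
\<close>

definition spl :: "nat \<Rightarrow> nat \<Rightarrow> bool" where
  "spl a b \<longleftrightarrow> (\<exists>P. perfect P \<and>
     (b = P \<and> P \<le> a \<and> a \<le> 2 * P + 1 \<and> a + 2 \<noteq> 2 * P \<or>
      a = 2 * P + 1 \<and> P \<le> b \<and> b \<le> 2 * P + 1 \<and> b + 2 \<noteq> 2 * P \<or>
      a + 3 = 2 * P \<and> b = P + 1 \<or>
      a = 2 * P + 2 \<and> b + 3 = 2 * P))"

lemma perfect_4: "perfect 4"
  unfolding perfect_def by (rule exI[of _ 0]) simp

lemma perfect_double: "perfect P \<Longrightarrow> perfect (2 * P + 1)"
proof -
  assume "perfect P"
  then obtain k where "P + 1 = 5 * 2 ^ k" unfolding perfect_def by blast
  then have "2 * P + 1 + 1 = 5 * 2 ^ Suc k" by simp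
  then show ?thesis unfolding perfect_def by blast
qed

lemma perfect_ge: "perfect P \<Longrightarrow> 4 \<le> P"
proof -
  assume "perfect P"
  then obtain k where "P + 1 = 5 * 2 ^ k" unfolding perfect_def by blast
  moreover have "1 \<le> (2::nat) ^ k" by simp
  ultimately show ?thesis by linarith
qed

lemma perfect_less: "perfect Q \<Longrightarrow> perfect P \<Longrightarrow> Q < P \<Longrightarrow> 2 * Q + 1 \<le> P"
proof -
  assume "perfect Q" "perfect P" "Q < P"
  then obtain j k where jk: "Q + 1 = 5 * 2 ^ j" "P + 1 = 5 * 2 ^ k" unfolding perfect_def by auto
  with \<open>Q < P\<close> have "(2::nat) ^ j < 2 ^ k" by linarith
  then have "Suc j \<le> k" by (simp add: Suc_leI)
  then have "(2::nat) ^ Suc j \<le> 2 ^ k" by (rule power_increasing) simp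
  then show ?thesis using jk by simp
qed

text \<open>Perfect orders form the chain 4, 9, 19, ... under doubling plus one. If \<open>Q\<close>
  is the smaller one, the case of adjacent members is kept apart from larger gaps, because it needs
  its own argument later.\<close>

lemma perfect_cases:
  assumes "perfect Q" "perfect P"
  obtains "Q = P" | "P = 2 * Q + 1" | "4 * Q + 3 \<le> P" | "2 * P + 1 \<le> Q"
proof -
  consider "Q = P" | "2 * Q + 1 = P" | "2 * Q + 1 < P" | "P < Q"
    using perfect_less[OF assms] by linarith
  then show thesis
    using that perfect_less[OF perfect_double[OF assms(1)] assms(2)] perfect_less[OF assms(2,1)]
    by cases auto
qed

text \<open>The ranges of consecutive scales share exactly one endpoint: twice
  \<open>2 * P + 1\<close> is \<open>4 * P + 2\<close>.\<close>

lemma perfect_exists: "8 \<le> N \<Longrightarrow> \<exists>P. perfect P \<and> 2 * P \<le> N \<and> N \<le> 4 * P + 2"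
proof (induction N rule: dec_induct)
  case base
  show ?case using perfect_4 by (intro exI[of _ 4]) simp
next
  case (step N)
  then obtain P where P: "perfect P" "2 * P \<le> N" "N \<le> 4 * P + 2" by auto
  show ?case
  proof (cases "N = 4 * P + 2")
    case True
    then show ?thesis using perfect_double[OF P(1)] by (intro exI[of _ "2 * P + 1"]) simp
  next
    case False
    then show ?thesis using P by (intro exI[of _ P]) simp
  qed
qed

text \<open>The extra facts locate the parts by thresholds on the sum, the form in which
  \<open>resplit_scale\<close> compares them with another splitting.\<close>

lemma spl_exists_scale:
  assumes "perfect P" "2 * P \<le> N" "N \<le> 4 * P + 2"
  obtains s t where "spl s t" "s + t = N" "N \<le> 3 * P + 1 \<Longrightarrow> N + 2 \<noteq> 3 * P \<Longrightarrow> t = P"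
    "N + 2 = 3 * P \<Longrightarrow> s + 3 = 2 * P" "N \<ge> 3 * P + 2 \<Longrightarrow> 2 * P + 1 \<le> s"
proof -
  have P4: "4 \<le> P" using assms(1) perfect_ge by auto
  consider "N + 2 = 3 * P" | "N \<le> 3 * P + 1" "N + 2 \<noteq> 3 * P" | "N + 1 = 4 * P"
    | "N \<ge> 3 * P + 2" "N + 1 \<noteq> 4 * P" by linarith
  then show thesis
  proof cases
    case 1
    have "spl (2 * P - 3) (P + 1)" unfolding spl_def using assms(1) P4 by (intro exI[of _ P]) auto
    then show thesis by (rule that) (use 1 P4 in auto)
  next
    case 2
    have "spl (N - P) P" unfolding spl_def using assms 2 P4 by (intro exI[of _ P]) auto
    then show thesis by (rule that) (use 2 assms P4 in auto)
  next
    case 3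
    have "spl (2 * P + 2) (2 * P - 3)" unfolding spl_def using assms(1) P4 by (intro exI[of _ P]) auto
    then show thesis by (rule that) (use 3 P4 in auto)
  next
    case 4
    have "spl (2 * P + 1) (N - (2 * P + 1))" unfolding spl_def using assms 4 P4 by (intro exI[of _ P]) auto
    then show thesis by (rule that) (use 4 assms P4 in auto)
  qed
qed

lemma splE:
  assumes "spl a b"
  obtains P where "perfect P" "b = P" "P \<le> a" "a \<le> 2 * P + 1" "a + 2 \<noteq> 2 * P"
  | P where "perfect P" "a = 2 * P + 1" "P \<le> b" "b \<le> 2 * P + 1" "b + 2 \<noteq> 2 * P"
  | P where "perfect P" "a + 3 = 2 * P" "b = P + 1"
  | P where "perfect P" "a = 2 * P + 2" "b + 3 = 2 * P"
  using assms unfolding spl_def by blast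

text \<open>The sum determines the scale that \<open>spl\<close> hides under a quantifier. At a
  shared endpoint of two ranges both scales describe the same pair.\<close>

lemma spl_scale:
  assumes "spl a b" "perfect P" "2 * P \<le> a + b" "a + b \<le> 4 * P + 2"
  shows "b = P \<and> P \<le> a \<and> a \<le> 2 * P + 1 \<and> a + 2 \<noteq> 2 * P \<or>
      a = 2 * P + 1 \<and> P \<le> b \<and> b \<le> 2 * P + 1 \<and> b + 2 \<noteq> 2 * P \<or>
      a + 3 = 2 * P \<and> b = P + 1 \<or>
      a = 2 * P + 2 \<and> b + 3 = 2 * P"
  using assms(1)
proof (cases rule: splE)
  case (1 Q)
  note Q4 = perfect_ge[OF 1(1)] perfect_ge[OF assms(2)]
  show ?thesis using perfect_cases[OF 1(1) assms(2)] by cases (use 1 Q4 assms(3,4) in linarith)+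
next
  case (2 Q)
  note Q4 = perfect_ge[OF 2(1)] perfect_ge[OF assms(2)]
  show ?thesis using perfect_cases[OF 2(1) assms(2)] by cases (use 2 Q4 assms(3,4) in linarith)+
next
  case (3 Q)
  note Q4 = perfect_ge[OF 3(1)] perfect_ge[OF assms(2)]
  show ?thesis using perfect_cases[OF 3(1) assms(2)] by cases (use 3 Q4 assms(3,4) in linarith)+
next
  case (4 Q)
  note Q4 = perfect_ge[OF 4(1)] perfect_ge[OF assms(2)]
  show ?thesis using perfect_cases[OF 4(1) assms(2)] by cases (use 4 Q4 assms(3,4) in linarith)+
qed

lemma spl_sum_ge: "spl a b \<Longrightarrow> 8 \<le> a + b \<and> b \<le> a \<and> 4 \<le> b"
  by (erule splE; drule perfect_ge; linarith)

lemma spl_unique: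
  assumes "spl a b" "spl c d" "a + b = c + d"
  shows "a = c \<and> b = d"
proof -
  obtain P where P: "perfect P" "2 * P \<le> a + b" "a + b \<le> 4 * P + 2"
    using perfect_exists spl_sum_ge[OF assms(1)] by blast
  have "4 \<le> P" using P(1) by (rule perfect_ge)
  then show ?thesis
    using spl_scale[OF assms(1) P] spl_scale[OF assms(2) P(1)] P(2,3) assms(3)
    by (elim disjE conjE) linarith+
qed

text \<open>Within \<open>[P, 2 * P + 1]\<close> a pair outside \<open>spl\<close> is too even, so
  resplitting enlarges the larger part. The excluded pair \<open>(2 * P - 2, P)\<close> is the one
  that resplits to something more even, namely \<open>(2 * P - 3, P + 1)\<close>.\<close>

lemma resplit_scale:
  assumes "perfect P" "P \<le> u" "u \<le> x" "x \<le> 2 * P + 1" "\<not> (x + 2 = 2 * P \<and> u = P)" "\<not> spl x u"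
  obtains s t where "spl s t" "s + t = x + u" "x < s"
proof -
  have "2 * P \<le> x + u" "x + u \<le> 4 * P + 2" using assms by auto
  then obtain s t where st: "spl s t" "s + t = x + u" "x + u \<le> 3 * P + 1 \<Longrightarrow> x + u + 2 \<noteq> 3 * P \<Longrightarrow> t = P"
    "x + u + 2 = 3 * P \<Longrightarrow> s + 3 = 2 * P" "x + u \<ge> 3 * P + 2 \<Longrightarrow> 2 * P + 1 \<le> s"
    using spl_exists_scale[OF assms(1)] by metis
  have "x \<le> s" using st(2-) assms(2-5) by linarith
  moreover have "x \<noteq> s" using st(1,2) assms(6) by auto
  ultimately show thesis using that[OF st(1,2)] by simp
qed

text \<open>Frees the arithmetic from trees. The recursion starts at 7 because at orders 4 and 5
  stars beat every root of degree two: 13 against 14, and 22 against 23.\<close>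

locale split_sequence =
  fixes z :: "nat \<Rightarrow> int"
  assumes z_le: "1 \<le> a \<Longrightarrow> 1 \<le> b \<Longrightarrow> z (a + b + 1) \<le> z a * z b - 1"
    and z_eq: "7 \<le> n \<Longrightarrow> \<exists>a b. 1 \<le> b \<and> b \<le> a \<and> a + b + 1 = n \<and> z n = z a * z b - 1"
    and z_mono: "1 \<le> a \<Longrightarrow> a < b \<Longrightarrow> z a < z b"
    and z_small: "z 1 = 3" "z 2 = 5" "z 3 = 8" "z 4 = 13" "z 5 = 22" "z 6 = 38"
begin

definition opt :: "nat \<Rightarrow> nat \<Rightarrow> bool" where
  "opt a b \<longleftrightarrow> 1 \<le> b \<and> b \<le> a \<and> z (a + b + 1) = z a * z b - 1"

lemma z_ge_3: "1 \<le> a \<Longrightarrow> 3 \<le> z a"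
  using z_mono[of 1 a] z_small(1) by (cases "a = 1") auto

lemma z_mono_le: "1 \<le> a \<Longrightarrow> a \<le> b \<Longrightarrow> z a \<le> z b"
  using z_mono[of a b] by (cases "a = b") auto

lemma opt_le: "opt a b \<Longrightarrow> 1 \<le> c \<Longrightarrow> 1 \<le> d \<Longrightarrow> c + d = a + b \<Longrightarrow> z a * z b \<le> z c * z d"
  unfolding opt_def using z_le[of c d] by auto

text \<open>
  Exchange arguments: $x + b$, respectively $x + u$, is split anew as $s + t$. The
  product of the two factors does not grow, and the subtracted terms grow strictly if the larger
  part moves towards the root, respectively towards the larger sibling.
\<close>

lemma resplit_root:
  assumes ab: "opt a b \<or> opt b a" and xy: "a = x + y + 1" "z a = z x * z y - 1" "1 \<le> x" "1 \<le> y"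
    and st: "1 \<le> s" "1 \<le> t" "s + t = x + b" "z s * z t \<le> z x * z b"
  shows "s \<le> b"
proof (rule ccontr)
  assume "\<not> s \<le> b"
  have b1: "1 \<le> b" using ab unfolding opt_def by auto
  then have "z b < z s" using z_mono \<open>\<not> s \<le> b\<close> by auto
  have "z a * z b \<le> z (t + y + 1) * z s"
    using ab opt_le[of a b "t + y + 1" s] opt_le[of b a s "t + y + 1"] st xy by (auto simp: mult.commute)
  also have "\<dots> \<le> (z t * z y - 1) * z s"
    using z_le[of t y] z_ge_3[of s] st xy by (intro mult_right_mono) auto
  also have "\<dots> = (z s * z t) * z y - z s" by (simp add: algebra_simps)
  also have "\<dots> \<le> (z x * z b) * z y - z s"
    using st(4) z_ge_3[of y] xy by (simp add: mult_right_mono)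
  also have "\<dots> < (z x * z b) * z y - z b" using \<open>z b < z s\<close> by simp
  also have "\<dots> = z a * z b" unfolding xy(2) by (simp add: algebra_simps)
  finally show False by simp
qed

lemma resplit_cross:
  assumes ab: "opt a b \<or> opt b a"
    and xy: "a = x + y + 1" "z a = z x * z y - 1" "1 \<le> x" "1 \<le> y"
    and uv: "b = u + v + 1" "z b = z u * z v - 1" "1 \<le> u" "1 \<le> v"
    and st: "1 \<le> s" "1 \<le> t" "s + t = x + u" "z s * z t \<le> z x * z u"
    and "v < y" "u \<le> s"
  shows "s \<le> x"
proof (rule ccontr)
  assume "\<not> s \<le> x"
  define X Y U V S T where "X = z x" "Y = z y" "U = z u" "V = z v" "S = z s" "T = z t"
  note defs = this
  have "X < S" using z_mono[of x s] \<open>\<not> s \<le> x\<close> xy defs by auto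
  have "U \<le> S" using z_mono_le[of u s] \<open>u \<le> s\<close> uv defs by auto
  have "V < Y" using z_mono[of v y] \<open>v < y\<close> uv defs by auto
  have "0 < X" "0 < Y" "0 < U" "0 < V" "0 < S" "0 < T" using z_ge_3 xy uv st defs by (auto simp: order.strict_trans2[of 0 3])
  have ST: "S * T \<le> X * U" using st defs by simp
  have "z a * z b \<le> z (s + y + 1) * z (t + v + 1)"
    using ab opt_le[of a b "s + y + 1" "t + v + 1"] opt_le[of b a "t + v + 1" "s + y + 1"] st xy uv
    by (auto simp: mult.commute)
  also have "\<dots> \<le> (S * Y - 1) * (T * V - 1)"
    using z_le[of s y] z_le[of t v] z_ge_3[of "s + y + 1"] z_ge_3[of "t + v + 1"] st xy uv
    unfolding defs by (intro mult_mono) auto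
  finally have le: "(X * Y - 1) * (U * V - 1) \<le> (S * Y - 1) * (T * V - 1)"
    using xy(2) uv(2) defs by simp
  define d where "d = X * U - S * T"
  have d: "0 \<le> d" using ST d_def by simp
  \<comment> \<open>After expansion the terms of degree four differ by \<open>Y * V * d\<close>.
    Multiplying by \<open>S\<close> then allows the factor \<open>S * (U - T)\<close> to be
    rewritten without \<open>T\<close>.\<close>
  have *: "Y * V * d + Y * (S - X) \<le> V * (U - T)"
    using le unfolding d_def by (simp add: algebra_simps)
  have "S * (U - T) = U * (S - X) + d" unfolding d_def by (simp add: algebra_simps)
  then have "S * (V * (U - T)) = V * U * (S - X) + V * d" by (metis (no_types, lifting) distrib_left mult.assoc mult.left_commute)
  moreover have "S * (Y * V * d + Y * (S - X)) \<le> S * (V * (U - T))"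
    using * \<open>0 < S\<close> by (simp add: mult_left_mono)
  ultimately have "S * Y * (S - X) + S * Y * V * d \<le> V * U * (S - X) + V * d"
    by (simp add: algebra_simps)
  \<comment> \<open>Here \<open>v < y\<close> and \<open>u <= s\<close> enter: the enlarged factor
    \<open>S\<close> must sit next to the larger sibling for the exchange to pay.\<close>
  moreover have "V * U * (S - X) < S * Y * (S - X)"
  proof -
    have "V * U < Y * S" using \<open>V < Y\<close> \<open>U \<le> S\<close> \<open>0 < U\<close> \<open>0 < V\<close> \<open>0 < S\<close>
      by (metis less_le_trans mult_strict_right_mono mult_left_mono order_less_imp_le order_less_trans)
    then show ?thesis using \<open>X < S\<close> by (simp add: mult.commute)
  qed
  moreover have "V * d \<le> S * Y * V * d"
  proof -
    have "1 \<le> S * Y" using \<open>0 < S\<close> \<open>0 < Y\<close> by (simp add: int_one_le_iff_zero_less)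
    then have "1 * (V * d) \<le> (S * Y) * (V * d)" using d \<open>0 < V\<close> by (intro mult_right_mono) auto
    then show ?thesis by (simp add: mult.assoc)
  qed
  ultimately show False by linarith
qed

end

text \<open>The values $z_n$ for small $n$; the index 0 is a dummy.\<close>

definition table :: "int list" where
  "table = [0, 3, 5, 8, 13, 22, 38, 63, 103, 168, 285, 483, 818, 1338, 2183, 3695, 6269, 10583,
    17303, 28223, 47879, 81143, 137423, 224783, 366743, 620759, 1053074, 1777943, 2906903, 4741463,
    8043554, 13631708, 23086413, 37762373, 61610808, 104283984, 176912904, 298684008, 488342568,
    796537728]"

text \<open>An executable form of \<open>spl\<close> with the scales 4 and 9, whose ranges cover the
  sums 8 to 38. The pairs (3, 3) and (4, 3) are the optima for the sums 6 and 7, below the first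
  scale.\<close>

definition small_spl :: "nat \<Rightarrow> nat \<Rightarrow> bool" where
  "small_spl a b \<longleftrightarrow> (\<exists>P\<in>{4, 9}. b = P \<and> P \<le> a \<and> a \<le> 2 * P + 1 \<and> a + 2 \<noteq> 2 * P \<or>
      a = 2 * P + 1 \<and> P \<le> b \<and> b \<le> 2 * P + 1 \<and> b + 2 \<noteq> 2 * P \<or>
      a + 3 = 2 * P \<and> b = P + 1 \<or> a = 2 * P + 2 \<and> b + 3 = 2 * P) \<or> b = 3 \<and> (a = 3 \<or> a = 4)"

text \<open>The equality case is recorded as well, so that one evaluation gives both the lower bound
  of the recursion and the list of pairs that can attain it.\<close>

lemma table_le: "list_all (\<lambda>n. list_all (\<lambda>b. let a = n - 1 - b; t = table ! n + 1; u = table ! a * table ! b in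
    b \<le> a \<longrightarrow> (if t = u then small_spl a b else t < u)) [1..<n - 1]) [7..<40]"
  by code_simp

lemma table_eq: "list_all (\<lambda>n. list_ex (\<lambda>b. table ! n = table ! (n - 1 - b) * table ! b - 1) [1..<n - 1]) [7..<40]"
  by code_simp

lemma small_spl_imp_spl:
  assumes "small_spl a b" "8 \<le> a + b"
  shows "spl a b"
proof -
  have "perfect 4" "perfect 9" using perfect_4 perfect_double[OF perfect_4] by simp_all
  with assms show ?thesis unfolding small_spl_def spl_def by auto
qed

context split_sequence
begin

lemma z_table: "1 \<le> n \<Longrightarrow> n < 40 \<Longrightarrow> z n = table ! n"
proof (induction n rule: less_induct)
  case (less n)
  show ?case
  proof (cases "n < 7")
    case True
    then have "n \<in> {1, 2, 3, 4, 5, 6}" using less by auto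
    then show ?thesis using z_small by (auto simp: table_def)
  next
    case False
    then obtain a b where ab: "1 \<le> b" "b \<le> a" "a + b + 1 = n" "z n = z a * z b - 1"
      using z_eq[of n] by auto
    have "n \<in> set [7..<40]" "b \<in> set [1..<n - 1]" "a = n - 1 - b"
      unfolding set_upt atLeastLessThan_iff using False less(3) ab by linarith+
    then have "table ! n + 1 \<le> table ! a * table ! b"
      using table_le ab(2) unfolding list_all_iff Let_def by (metis order.refl order_less_imp_le)
    moreover have "z a = table ! a" "z b = table ! b" using less ab by auto
    ultimately have 1: "table ! n \<le> z n" using ab by simp
    obtain d where d: "d \<in> set [1..<n - 1]" "table ! n = table ! (n - 1 - d) * table ! d - 1"
      using table_eq \<open>n \<in> set [7..<40]\<close> unfolding list_all_iff list_ex_iff by blast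
    then have "z n \<le> z (n - 1 - d) * z d - 1" using z_le[of "n - 1 - d" d] by auto
    moreover have "z (n - 1 - d) = table ! (n - 1 - d)" "z d = table ! d" using less d(1) by auto
    ultimately show ?thesis using 1 d(2) by simp
  qed
qed

lemma opt_small:
  assumes "opt a b" "6 \<le> a + b" "a + b \<le> 38"
  shows "small_spl a b"
proof -
  have ab: "1 \<le> b" "b \<le> a" "z (a + b + 1) = z a * z b - 1" using assms unfolding opt_def by auto
  have "a + b + 1 \<in> set [7..<40]" "b \<in> set [1..<(a + b + 1) - 1]" "a = (a + b + 1) - 1 - b"
    unfolding set_upt atLeastLessThan_iff using assms ab by linarith+
  moreover have "table ! (a + b + 1) + 1 = table ! a * table ! b"
    using ab z_table[of a] z_table[of b] z_table[of "a + b + 1"] assms by auto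
  ultimately show ?thesis using table_le ab(2) unfolding list_all_iff Let_def by metis
qed

text \<open>Swaps between the two branches give \<open>b2 <= b1 <= a2 <= a1 <= b\<close>.
  Regroupings with a fixed sum then force \<open>spl b a1\<close>, or \<open>spl\<close> for one
  part of \<open>a\<close> with one part of \<open>b\<close>, wherever \<open>resplit_scale\<close>
  applies. Comparing the scales \<open>P\<close> of \<open>(a1, a2)\<close> and \<open>Q\<close> of
  \<open>(b1, b2)\<close> leaves only pairs in \<open>spl\<close>.\<close>

lemma opt_imp_spl_step:
  assumes "opt a b" "39 \<le> a + b"
    and IH: "\<And>c d. c + d < a + b \<Longrightarrow> 8 \<le> c + d \<Longrightarrow> opt c d \<Longrightarrow> spl c d"
  shows "spl a b"
proof (rule ccontr)
  assume not: "\<not> spl a b"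
  have ba: "1 \<le> b" "b \<le> a" using assms(1) unfolding opt_def by auto
  have "20 \<le> a" using ba assms(2) by linarith
  \<comment> \<open>By induction the optimum for \<open>s + t\<close> is attained by a pair in
    \<open>spl\<close>, and the sum determines that pair, so it is \<open>(s, t)\<close>.\<close>
  have spl_le: "z s * z t \<le> z x * z u" if "spl s t" "s + t = x + u" "s + t < a + b" "1 \<le> x" "1 \<le> u" for s t x u
  proof -
    have "8 \<le> s + t" using spl_sum_ge[OF that(1)] by simp
    then obtain c d where cd: "1 \<le> d" "d \<le> c" "c + d + 1 = s + t + 1" "z (s + t + 1) = z c * z d - 1"
      using z_eq[of "s + t + 1"] by auto
    then have "opt c d" unfolding opt_def by (metis add_right_imp_eq)
    then have "spl c d" using IH[of c d] cd that \<open>8 \<le> s + t\<close> by simp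
    then have "c = s" "d = t" using spl_unique[of c d s t] that cd by auto
    then show ?thesis using opt_le[OF \<open>opt c d\<close>, of x u] that by auto
  qed
  have splits: "\<exists>x y. spl x y \<and> c = x + y + 1 \<and> z c = z x * z y - 1" if "9 \<le> c" "c \<le> a" for c
  proof -
    obtain x y where xy: "1 \<le> y" "y \<le> x" "x + y + 1 = c" "z c = z x * z y - 1"
      using z_eq[of c] \<open>9 \<le> c\<close> by auto
    then have "opt x y" unfolding opt_def by auto
    then have "spl x y" using IH[of x y] xy that ba by auto
    then show ?thesis using xy by auto
  qed
  obtain a1 a2 where a: "spl a1 a2" "a = a1 + a2 + 1" "z a = z a1 * z a2 - 1"
    using splits[of a] \<open>20 \<le> a\<close> by auto
  have a12: "a2 \<le> a1" "4 \<le> a2" using spl_sum_ge[OF a(1)] by auto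
  \<comment> \<open>The exchange that merely swaps \<open>a1\<close> and \<open>b\<close>.\<close>
  have E2: "a1 \<le> b"
    using resplit_root[of a b a1 a2 a1 b] assms(1) a a12 ba by auto
  have "9 \<le> b" using E2 a(2) a12 \<open>20 \<le> a\<close> by linarith
  then obtain b1 b2 where b: "spl b1 b2" "b = b1 + b2 + 1" "z b = z b1 * z b2 - 1"
    using splits[of b] ba by auto
  have b12: "b2 \<le> b1" "4 \<le> b2" using spl_sum_ge[OF b(1)] by auto
  \<comment> \<open>The exchange that swaps \<open>a2\<close> and \<open>b1\<close>. If
    \<open>b1\<close> were the larger, \<open>b <= a\<close> would give the condition
    \<open>b2 < a1\<close> of the cross exchange.\<close>
  have E1: "b1 \<le> a2"
  proof (rule ccontr)
    assume "\<not> b1 \<le> a2"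
    then have "b2 < a1" using a(2) b(2) ba(2) by linarith
    then show False
      using resplit_cross[of a b a2 a1 b1 b2 b1 a2] assms(1) a b a12 b12 \<open>\<not> b1 \<le> a2\<close> by (auto simp: mult.commute)
  qed
  \<comment> \<open>Otherwise the sum \<open>a1 + b\<close> resplits with a part larger than
    \<open>b\<close>, which becomes a child branch of the root and contradicts
    \<open>resplit_root\<close>.\<close>
  have C1: "spl b a1" if P: "perfect P" "P \<le> a1" "b \<le> 2 * P + 1" "\<not> (b + 2 = 2 * P \<and> a1 = P)" for P
  proof (rule ccontr)
    assume "\<not> spl b a1"
    then obtain s t where st: "spl s t" "s + t = b + a1" "b < s"
      by (rule resplit_scale[OF P(1,2) E2 P(3,4)])
    then have "z s * z t \<le> z a1 * z b" using spl_le[of s t a1 b] a(2) a12 ba by auto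
    then show False
      using resplit_root[of a b a1 a2 s t] assms(1) a a12 ba st spl_sum_ge[OF st(1)] by auto
  qed
  \<comment> \<open>The same argument across the branches: \<open>x\<close> is a part of
    \<open>a\<close>, \<open>u\<close> is a part of \<open>b\<close>, and \<open>y\<close>,
    \<open>v\<close> are their siblings.\<close>
  have C2: "spl x u" if P: "perfect P" "P \<le> u" "u \<le> x" "x \<le> 2 * P + 1" "\<not> (x + 2 = 2 * P \<and> u = P)"
    and xy: "x = a1 \<and> y = a2 \<or> x = a2 \<and> y = a1" and uv: "u = b1 \<and> v = b2 \<or> u = b2 \<and> v = b1" and "v < y"
    for P x y u v
  proof (rule ccontr)
    assume "\<not> spl x u"
    then obtain s t where st: "spl s t" "s + t = x + u" "x < s"
      by (rule resplit_scale[OF P])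
    have x: "a = x + y + 1" "z a = z x * z y - 1" "1 \<le> x" "1 \<le> y"
      using xy a(2,3) a12 by (auto simp: mult.commute)
    have u: "b = u + v + 1" "z b = z u * z v - 1" "1 \<le> u" "1 \<le> v"
      using uv b(2,3) b12 by (auto simp: mult.commute)
    have "z s * z t \<le> z x * z u" using spl_le[OF st(1,2)] x u st(2) by simp
    moreover have "1 \<le> s" "1 \<le> t" using spl_sum_ge[OF st(1)] by simp_all
    ultimately have "s \<le> x"
      using resplit_cross[OF disjI1[OF assms(1)] x u _ _ st(2) _ \<open>v < y\<close>] P(3) st(3) by simp
    then show False using st(3) by simp
  qed
  obtain P where P: "perfect P" "2 * P \<le> a1 + a2" "a1 + a2 \<le> 4 * P + 2"
    using perfect_exists[of "a1 + a2"] a(2) \<open>20 \<le> a\<close> by auto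
  \<comment> \<open>\<open>a1 + a2 >= 19\<close> exceeds \<open>4 * 4 + 2\<close>, the end of the
    range of scale 4. This fixes the length of the table.\<close>
  have "9 \<le> P" using P(2,3) a(2) \<open>20 \<le> a\<close> perfect_less[OF perfect_4 P(1)] perfect_ge[OF P(1)] by (cases "P = 4") auto
  note P' = perfect_double[OF P(1)]
  obtain Q where Q: "perfect Q" "2 * Q \<le> b1 + b2" "b1 + b2 \<le> 4 * Q + 2"
    using perfect_exists[of "b1 + b2"] b(2) \<open>9 \<le> b\<close> by auto
  have "4 \<le> Q" using perfect_ge Q(1) by auto
  note A = spl_scale[OF a(1) P] and B = spl_scale[OF b(1) Q]
  have spl1: "spl a b" if "perfect R" "b = R" "R \<le> a" "a \<le> 2 * R + 1" "a + 2 \<noteq> 2 * R" for R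
    using that unfolding spl_def by auto
  have spl2: "spl a b" if "perfect R" "a = 2 * R + 1" "R \<le> b" "b \<le> 2 * R + 1" "b + 2 \<noteq> 2 * R" for R
    using that unfolding spl_def by auto
  have spl3: "spl a b" if "perfect R" "a + 3 = 2 * R" "b = R + 1" for R
    using that unfolding spl_def by auto
  have spl4: "spl a b" if "perfect R" "a = 2 * R + 2" "b + 3 = 2 * R" for R
    using that unfolding spl_def by auto
  have at_P: "u = P \<or> x = 2 * P + 1 \<or> x + 3 = 2 * P \<and> u = P + 1"
    if "spl x u" "P \<le> u" "x \<le> 2 * P + 1" for x u
    using spl_scale[OF that(1) P(1)] that spl_sum_ge[OF that(1)] by linarith
  show False
    using perfect_cases[OF Q(1) P(1)]
  proof cases
    \<comment> \<open>Both branches are split at the same scale, so the pairs found for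
      \<open>(a, b)\<close> belong to the next scale \<open>2 * P + 1\<close>.\<close>
    case 1
    note B = B[unfolded 1]
    from A show False
    proof (elim disjE conjE)
      assume A1: "a2 = P" "P \<le> a1" "a1 \<le> 2 * P + 1"
      then have "b1 = P \<and> b2 = P" using B E1 \<open>9 \<le> P\<close> by linarith
      then show False using spl1[OF P'] not a(2) b(2) A1 \<open>9 \<le> P\<close> by auto
    next
      assume A2: "a1 = 2 * P + 1" "P \<le> a2" "a2 \<le> 2 * P + 1" "a2 + 2 \<noteq> 2 * P"
      from B show False
      proof (elim disjE conjE)
        assume B1: "b2 = P" "P \<le> b1" "b1 \<le> 2 * P + 1"
        then have "spl a2 b1" using C2[of P b1 a2 a1 b2] A2 P(1) E1 by auto
        then have "b1 = P \<or> a2 = 2 * P + 1 \<or> a2 + 3 = 2 * P \<and> b1 = P + 1"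
          using at_P B1 A2 by auto
        then show False
          using spl1[OF P'] spl2[OF P'] spl3[OF P'] not a(2) b(2) A2 B1 \<open>9 \<le> P\<close> by auto
      next
        assume B2: "b1 = 2 * P + 1" "P \<le> b2" "b2 \<le> 2 * P + 1" "b2 + 2 \<noteq> 2 * P"
        then have "a2 = 2 * P + 1" using E1 A2 by auto
        then show False using spl2[OF P'] not a(2) b(2) A2 B2 by auto
      next
        assume B3: "b1 + 3 = 2 * P" "b2 = P + 1"
        then have "spl a2 b1" using C2[of P b1 a2 a1 b2] A2 P(1) E1 \<open>9 \<le> P\<close> by auto
        then have "a2 = 2 * P + 1" using at_P[of a2 b1] B3 A2 \<open>9 \<le> P\<close> by auto
        then show False using spl2[OF P'] not a(2) b(2) A2 B3 \<open>9 \<le> P\<close> by auto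
      next
        assume "b1 = 2 * P + 2" "b2 + 3 = 2 * P"
        then show False using E1 A2 by simp
      qed
    next
      assume A3: "a1 + 3 = 2 * P" "a2 = P + 1"
      then have B1: "b2 = P" "P \<le> b1" using B E1 \<open>9 \<le> P\<close> by linarith+
      then have "spl a2 b1" using C2[of P b1 a2 a1 b2] A3 P(1) E1 \<open>9 \<le> P\<close> by auto
      then have "b1 = P" using at_P[of a2 b1] B1 A3 \<open>9 \<le> P\<close> by auto
      then show False using spl1[OF P'] not a(2) b(2) A3 B1 \<open>9 \<le> P\<close> by auto
    next
      assume A4: "a1 = 2 * P + 2" "a2 + 3 = 2 * P"
      then consider "b2 = P" "P \<le> b1" | "b1 + 3 = 2 * P" "b2 = P + 1" using B E1 \<open>9 \<le> P\<close> by linarith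
      then show False
      proof cases
        case 1
        then have "spl a2 b1" using C2[of P b1 a2 a1 b2] A4 P(1) E1 \<open>9 \<le> P\<close> by auto
        then have "b1 = P \<or> b1 = P + 1" using at_P[of a2 b1] 1 A4 \<open>9 \<le> P\<close> by auto
        \<comment> \<open>The alternative \<open>b1 = P\<close> would give
          \<open>b = 2 * P + 1\<close>, less than \<open>a1\<close>.\<close>
        then have "b = 2 * P + 2" using 1 A4 E2 b(2) by auto
        then have "spl (2 * P + 2) (2 * P + 2)" using C1[OF P'] A4 \<open>9 \<le> P\<close> by auto
        \<comment> \<open>The sum \<open>4 * P + 4\<close> belongs to scale
          \<open>2 * P + 1\<close>, where it splits as
          \<open>(2 * P + 3, 2 * P + 1)\<close>.\<close>
        then show False using spl_scale[OF _ P', of "2 * P + 2" "2 * P + 2"] \<open>9 \<le> P\<close> by auto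
      next
        case 2
        then have "spl a2 b1" using C2[of P b1 a2 a1 b2] A4 P(1) E1 \<open>9 \<le> P\<close> by auto
        then show False using at_P[of a2 b1] 2 A4 \<open>9 \<le> P\<close> by auto
      qed
    qed
  next
    case 2
    then have bP: "P \<le> b" "b \<le> 2 * P + 1" using Q b(2) by auto
    from A show False
    proof (elim disjE conjE)
      assume A1: "a2 = P" "P \<le> a1" "a1 \<le> 2 * P + 1"
      \<comment> \<open>With \<open>P = 2 * Q + 1\<close> this would make
        \<open>b1 + b2 = 4 * Q - 1\<close>, an exceptional sum at scale \<open>Q\<close>, whose
        larger part \<open>2 * Q + 2\<close> exceeds \<open>a2 = P\<close>.\<close>
      have exc: "b + 2 \<noteq> 2 * P"
      proof
        assume "b + 2 = 2 * P"
        then have "b1 = 2 * Q + 2" using B b(2) 2 \<open>4 \<le> Q\<close> by linarith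
        then show False using E1 A1 2 by simp
      qed
      then have "spl b a1" using C1[OF P(1)] A1 bP by auto
      then have "a1 = P \<or> b = 2 * P + 1 \<or> b + 3 = 2 * P \<and> a1 = P + 1" using at_P A1 bP by auto
      then show False
        using spl2[OF P(1)] spl1[OF P'] spl4[OF P(1)] exc not a(2) A1 bP \<open>9 \<le> P\<close> by auto
    next
      assume A2: "a1 = 2 * P + 1" "P \<le> a2" "a2 \<le> 2 * P + 1" "a2 + 2 \<noteq> 2 * P"
      then have "b = 2 * P + 1" using E2 bP by simp
      then show False using spl1[OF P'] not a(2) A2 by auto
    next
      assume A3: "a1 + 3 = 2 * P" "a2 = P + 1"
      then have "spl b a1" using C1[OF P(1)] bP \<open>9 \<le> P\<close> by auto
      then have "b = 2 * P + 1" using at_P[of b a1] A3 bP \<open>9 \<le> P\<close> by auto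
      then show False using spl1[OF P'] not a(2) A3 \<open>9 \<le> P\<close> by auto
    next
      assume "a1 = 2 * P + 2"
      then show False using E2 bP by simp
    qed
  next
    case 3
    then have "b \<le> P" using Q b(2) by auto
    then have "a1 = P \<and> a2 = P \<and> b = P" using A E2 \<open>9 \<le> P\<close> by linarith
    then show False using spl1[OF P(1)] not a(2) \<open>9 \<le> P\<close> by auto
  next
    case 4
    then have "a1 = 2 * P + 1 \<and> a2 = 2 * P + 1 \<and> b1 = 2 * P + 1 \<and> b2 = 2 * P + 1"
      using A B E1 b12 \<open>9 \<le> P\<close> by linarith
    then show False using spl1[OF perfect_double[OF P']] not a(2) b(2) by auto
  qed
qed

lemma opt_imp_spl: "opt a b \<Longrightarrow> 8 \<le> a + b \<Longrightarrow> spl a b"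
proof (induction "a + b" arbitrary: a b rule: less_induct)
  case less
  show ?case
  proof (cases "a + b \<le> 38")
    case True
    then show ?thesis using opt_small small_spl_imp_spl less by simp
  next
    case False
    then show ?thesis using opt_imp_spl_step[of a b] less by auto
  qed
qed

text \<open>The optimum for the sum is attained, only pairs in \<open>spl\<close> attain it, and
  there is just one such pair.\<close>

lemma spl_imp_opt:
  assumes "spl a b"
  shows "opt a b"
proof -
  have ge: "8 \<le> a + b" using spl_sum_ge[OF assms] by simp
  then obtain c d where cd: "1 \<le> d" "d \<le> c" "c + d + 1 = a + b + 1" "z (a + b + 1) = z c * z d - 1"
    using z_eq[of "a + b + 1"] by auto
  then have "opt c d" unfolding opt_def by (metis add_right_imp_eq)
  then have "spl c d" using opt_imp_spl cd(3) ge by simp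
  then show ?thesis using spl_unique[OF _ assms] cd(3) \<open>opt c d\<close> by auto
qed

end

subsection \<open>Counting infima closed sets\<close>

lemma pos_Node: "pos (Node ts) = insert [] (\<Union>i<length ts. (#) i ` pos (ts ! i))"
proof -
  have "p \<in> pos (Node ts) \<longleftrightarrow> p \<in> insert [] (\<Union>i<length ts. (#) i ` pos (ts ! i))" for p
    by (cases p) (auto simp: pos_def)
  then show ?thesis by blast
qed

lemma finite_pos: "finite (pos t)"
proof (induction t)
  case (Node ts)
  then show ?case by (auto simp: pos_Node)
qed

lemma order_Node_index: "order (Node ts) = Suc (\<Sum>i<length ts. order (ts ! i))"
proof -
  have "card (\<Union>i<length ts. (#) i ` pos (ts ! i)) = (\<Sum>i<length ts. card ((#) i ` pos (ts ! i)))"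
    by (rule card_UN_disjoint) (auto simp: finite_pos)
  also have "\<dots> = (\<Sum>i<length ts. order (ts ! i))"
    by (intro sum.cong) (auto simp: order_def card_image)
  finally show ?thesis
    unfolding order_def pos_Node by (subst card_insert_disjoint) (auto simp: finite_pos)
qed

lemma order_Node: "order (Node ts) = Suc (\<Sum>t\<leftarrow>ts. order t)"
  unfolding order_Node_index by (simp add: sum_list_sum_nth atLeast0LessThan)

lemma order_pos: "1 \<le> order t"
  by (cases t) (simp add: order_Node)

definition closed_sets :: "tree \<Rightarrow> nat list set set" where
  "closed_sets t = {X. X \<subseteq> pos t \<and> infima_closed X}"

lemma finite_closed_sets: "finite (closed_sets t)"
  unfolding closed_sets_def by (rule finite_subset[of _ "Pow (pos t)"]) (auto simp: finite_pos)

lemma card_closed_sets: "card (closed_sets t) = Suc (I t)"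
proof -
  have "closed_sets t = insert {} {X. X \<subseteq> pos t \<and> X \<noteq> {} \<and> infima_closed X}"
    unfolding closed_sets_def infima_closed_def by auto
  moreover have "finite {X. X \<subseteq> pos t \<and> X \<noteq> {} \<and> infima_closed X}"
    using finite_closed_sets[of t] unfolding closed_sets_def by (rule rev_finite_subset) auto
  ultimately show ?thesis unfolding I_def by simp
qed

text \<open>Infima across different branches are the root. Once the root is present, the traces on
  the branches can be chosen independently, which is what makes the count a product.\<close>

definition graft :: "nat \<Rightarrow> (nat \<Rightarrow> nat list set) \<Rightarrow> nat list set" where
  "graft n F = insert [] (\<Union>i<n. (#) i ` F i)"

lemma Nil_in_graft: "[] \<in> graft n F"
  unfolding graft_def by simp

lemma Cons_in_graft: "i # p \<in> graft n F \<longleftrightarrow> i < n \<and> p \<in> F i"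
  unfolding graft_def by auto

lemma infima_closed_slice: "infima_closed X \<Longrightarrow> infima_closed {p. i # p \<in> X}"
  unfolding infima_closed_def by fastforce

lemma infima_closed_graft:
  assumes "\<And>i. i < n \<Longrightarrow> infima_closed (F i)"
  shows "infima_closed (graft n F)"
  unfolding infima_closed_def
proof (intro ballI)
  fix u v assume "u \<in> graft n F" "v \<in> graft n F"
  then show "lcp u v \<in> graft n F"
    using assms unfolding infima_closed_def
    by (cases u; cases v) (auto simp: Nil_in_graft Cons_in_graft)
qed

lemma closed_sets_with_root:
  "{X \<in> closed_sets (Node ts). [] \<in> X} =
    graft (length ts) ` (PiE {..<length ts} (\<lambda>i. closed_sets (ts ! i)))"
proof (intro equalityI subsetI)
  fix X assume "X \<in> {X \<in> closed_sets (Node ts). [] \<in> X}"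
  then have X: "X \<subseteq> pos (Node ts)" "infima_closed X" "[] \<in> X" by (auto simp: closed_sets_def)
  define F where "F = restrict (\<lambda>i. {p. i # p \<in> X}) {..<length ts}"
  have "F \<in> PiE {..<length ts} (\<lambda>i. closed_sets (ts ! i))"
    unfolding F_def using X infima_closed_slice[OF X(2)]
    by (auto simp: closed_sets_def pos_def)
  moreover have "graft (length ts) F = X"
  proof -
    have "p \<in> graft (length ts) F \<longleftrightarrow> p \<in> X" for p
      using X by (cases p) (auto simp: Nil_in_graft Cons_in_graft F_def pos_def)
    then show ?thesis by blast
  qed
  ultimately show "X \<in> graft (length ts) ` (PiE {..<length ts} (\<lambda>i. closed_sets (ts ! i)))" by blast
next
  fix X assume "X \<in> graft (length ts) ` (PiE {..<length ts} (\<lambda>i. closed_sets (ts ! i)))"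
  then obtain F where F: "F \<in> PiE {..<length ts} (\<lambda>i. closed_sets (ts ! i))" "X = graft (length ts) F" by auto
  have mem: "F i \<subseteq> pos (ts ! i)" "infima_closed (F i)" if "i < length ts" for i
    using F(1) that by (auto simp: PiE_iff closed_sets_def)
  have "X \<subseteq> pos (Node ts)" unfolding F(2) graft_def pos_Node using mem(1) by fastforce
  then show "X \<in> {X \<in> closed_sets (Node ts). [] \<in> X}"
    using infima_closed_graft[of "length ts" F] mem(2) F(2) by (auto simp: closed_sets_def graft_def)
qed

text \<open>Two elements in different branches would force the root into the set, so all elements
  lie in a single branch.\<close>

lemma closed_sets_without_root:
  "{X \<in> closed_sets (Node ts). [] \<notin> X} - {{}} =
    (\<Union>i<length ts. (`) ((#) i) ` (closed_sets (ts ! i) - {{}}))"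
proof (intro equalityI subsetI)
  fix X assume "X \<in> {X \<in> closed_sets (Node ts). [] \<notin> X} - {{}}"
  then have X: "X \<subseteq> pos (Node ts)" "infima_closed X" "[] \<notin> X" "X \<noteq> {}" by (auto simp: closed_sets_def)
  then obtain q where q: "q \<in> X" by blast
  with q X(3) obtain i p where "q = i # p" by (metis neq_Nil_conv)
  with \<open>q \<in> X\<close> X(1) have ip: "i # p \<in> X" "i < length ts" by (auto simp: pos_def)
  have same: "j = i" if "j # q \<in> X" for j q
  proof (rule ccontr)
    assume "j \<noteq> i"
    then have "lcp (j # q) (i # p) = []" by simp
    then show False using X(2,3) that ip unfolding infima_closed_def by metis
  qed
  have "X = (#) i ` {p. i # p \<in> X}"
  proof (intro equalityI subsetI)
    fix q assume "q \<in> X"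
    with X(3) obtain j p where "q = j # p" by (metis neq_Nil_conv)
    then show "q \<in> (#) i ` {p. i # p \<in> X}" using same[of j p] \<open>q \<in> X\<close> by blast
  qed blast
  moreover have "{p. i # p \<in> X} \<in> closed_sets (ts ! i) - {{}}"
    using infima_closed_slice[OF X(2)] X(1) ip by (auto simp: closed_sets_def pos_def)
  ultimately show "X \<in> (\<Union>i<length ts. (`) ((#) i) ` (closed_sets (ts ! i) - {{}}))" using ip(2) by blast
next
  fix X assume "X \<in> (\<Union>i<length ts. (`) ((#) i) ` (closed_sets (ts ! i) - {{}}))"
  then obtain i Y where iY: "i < length ts" "Y \<subseteq> pos (ts ! i)" "infima_closed Y" "Y \<noteq> {}" "X = (#) i ` Y"
    by (auto simp: closed_sets_def)
  then have "infima_closed X" unfolding infima_closed_def by auto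
  then show "X \<in> {X \<in> closed_sets (Node ts). [] \<notin> X} - {{}}"
    using iY by (auto simp: closed_sets_def pos_def)
qed

lemma I_Node_index: "I (Node ts) = (\<Prod>i<length ts. Suc (I (ts ! i))) + (\<Sum>i<length ts. I (ts ! i))"
proof -
  define A B where "A = {X \<in> closed_sets (Node ts). [] \<in> X}"
    and "B = {X \<in> closed_sets (Node ts). [] \<notin> X} - {{}}"
  have eq: "closed_sets (Node ts) = insert {} (A \<union> B)"
    by (auto simp: A_def B_def closed_sets_def infima_closed_def)
  have fin: "finite A" "finite B" using finite_closed_sets[of "Node ts"] by (auto simp: A_def B_def)
  have "card (closed_sets (Node ts)) = Suc (card (A \<union> B))"
    unfolding eq by (rule card_insert_disjoint) (use fin in \<open>auto simp: A_def B_def\<close>)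
  then have "I (Node ts) = card (A \<union> B)" by (simp add: card_closed_sets)
  also have "card (A \<union> B) = card A + card B"
    by (rule card_Un_disjoint) (use fin in \<open>auto simp: A_def B_def\<close>)
  also have "card A = (\<Prod>i<length ts. Suc (I (ts ! i)))"
  proof -
    have "inj_on (graft (length ts)) (PiE {..<length ts} (\<lambda>i. closed_sets (ts ! i)))"
    proof (rule inj_onI, rule PiE_ext)
      fix F G i assume "graft (length ts) F = graft (length ts) G" "i \<in> {..<length ts}"
      then have "p \<in> F i \<longleftrightarrow> p \<in> G i" for p
        using Cons_in_graft[of i p "length ts" F] Cons_in_graft[of i p "length ts" G] by simp
      then show "F i = G i" by blast
    qed
    then show ?thesis
      unfolding A_def closed_sets_with_root by (simp add: card_image card_PiE card_closed_sets)
  qed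
  also have "card B = (\<Sum>i<length ts. I (ts ! i))"
  proof -
    have "card B = (\<Sum>i<length ts. card ((`) ((#) i) ` (closed_sets (ts ! i) - {{}})))"
      unfolding B_def closed_sets_without_root
      by (rule card_UN_disjoint) (auto simp: finite_closed_sets)
    also have "\<dots> = (\<Sum>i<length ts. I (ts ! i))"
    proof (rule sum.cong[OF refl])
      fix i
      have "inj_on ((`) ((#) i)) (closed_sets (ts ! i) - {{}})"
        by (auto simp: inj_on_def inj_image_eq_iff)
      moreover have "{} \<in> closed_sets (ts ! i)" by (auto simp: closed_sets_def infima_closed_def)
      ultimately show "card ((`) ((#) i) ` (closed_sets (ts ! i) - {{}})) = I (ts ! i)"
        by (simp add: card_image card_closed_sets card_Diff_singleton)
    qed
    finally show ?thesis .
  qed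
  finally show ?thesis .
qed

definition val :: "tree \<Rightarrow> int" where
  "val t = int (I t)"

lemma val_Node: "val (Node ts) = (\<Prod>t\<leftarrow>ts. 1 + val t) + (\<Sum>t\<leftarrow>ts. val t)"
proof -
  have "(\<Prod>t\<leftarrow>ts. 1 + val t) = (\<Prod>i<length ts. int (Suc (I (ts ! i))))"
    by (simp add: prod.list_conv_set_nth atLeast0LessThan val_def)
  then show ?thesis
    unfolding val_def I_Node_index
    by (simp add: sum_list_sum_nth atLeast0LessThan flip: val_def)
qed

lemma val_pos: "1 \<le> val t"
proof (induction t)
  case (Node ts)
  then have "1 \<le> (\<Prod>t\<leftarrow>ts. 1 + val t) \<and> 0 \<le> (\<Sum>t\<leftarrow>ts. val t)"
  proof (induction ts)
    case (Cons t ts)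
    have "1 \<le> val t" "1 \<le> (\<Prod>t\<leftarrow>ts. 1 + val t) \<and> 0 \<le> (\<Sum>t\<leftarrow>ts. val t)" using Cons by auto
    moreover from this have "1 * 1 \<le> (1 + val t) * (\<Prod>t\<leftarrow>ts. 1 + val t)" by (intro mult_mono) auto
    ultimately show ?case by simp
  qed simp
  then show ?case by (simp add: val_Node)
qed

lemma prod_val_pos: "1 \<le> (\<Prod>t\<leftarrow>ts. 1 + val t)"
proof (induction ts)
  case (Cons t ts)
  then have "1 * 1 \<le> (1 + val t) * (\<Prod>t\<leftarrow>ts. 1 + val t)" using val_pos[of t] by (intro mult_mono) auto
  then show ?case by simp
qed simp

lemma sum_val_nonneg: "0 \<le> (\<Sum>t\<leftarrow>ts. val t)"
  using val_pos by (intro sum_list_nonneg) (auto intro: order_trans[OF zero_le_one])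

lemma sum_val_pos: "ts \<noteq> [] \<Longrightarrow> 1 \<le> (\<Sum>t\<leftarrow>ts. val t)"
  using val_pos sum_val_nonneg by (cases ts) (auto simp: add_increasing2)

lemma val_leaf: "val leaf = 1" and order_leaf: "order leaf = 1"
  by (simp_all add: leaf_def val_Node order_Node)

text \<open>This identity is the origin of the shift by two: it completes the product in
  \<open>(1 + x) * (1 + y) + x + y\<close>.\<close>

lemma val_pair: "val (Node [A, B]) + 2 = (val A + 2) * (val B + 2) - 1"
  by (simp add: val_Node algebra_simps)

lemma order_eq_1: "order t = Suc 0 \<longleftrightarrow> t = leaf"
proof (cases t)
  case (Node ts)
  then show ?thesis using order_pos[of "hd ts"] by (cases ts) (simp_all add: order_Node leaf_def)
qed

lemma leaf_or_val_ge: "t = leaf \<or> 3 \<le> val t"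
proof (cases t)
  case (Node ts)
  show ?thesis
  proof (cases ts)
    case (Cons u us)
    have "2 * 1 \<le> (1 + val u) * (\<Prod>t\<leftarrow>us. 1 + val t)"
      using val_pos[of u] prod_val_pos by (intro mult_mono) auto
    then show ?thesis
      using Node Cons val_pos[of u] sum_val_nonneg[of us] by (simp add: val_Node)
  qed (use Node in \<open>simp add: leaf_def\<close>)
qed

section \<open>Isomorphism of rooted trees\<close>

lemma iso_refl: "iso t t"
proof (induction t)
  case (Node ts)
  show ?case by (rule iso.intros[of _ _ id]) (use Node in \<open>auto simp: permutes_id\<close>)
qed

lemma iso_trans: "iso t u \<Longrightarrow> iso u v \<Longrightarrow> iso t v"
proof (induction arbitrary: v rule: iso.induct)
  case (1 ts us \<pi>)
  from \<open>iso (Node us) v\<close> obtain ws \<sigma> where v: "v = Node ws" "length us = length ws"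
      "\<sigma> permutes {..<length us}" "\<forall>i<length us. iso (us ! i) (ws ! \<sigma> i)"
    by (auto elim: iso.cases)
  show ?case unfolding v(1)
  proof (rule iso.intros)
    show "length ts = length ws" using 1 v by simp
    show "\<sigma> \<circ> \<pi> permutes {..<length ts}" using 1 v by (auto intro: permutes_compose)
    show "\<forall>i<length ts. iso (ts ! i) (ws ! (\<sigma> \<circ> \<pi>) i)"
    proof (intro allI impI)
      fix i assume i: "i < length ts"
      then have "\<pi> i < length us" using permutes_in_image[OF 1(2)] 1(1) by auto
      then show "iso (ts ! i) (ws ! (\<sigma> \<circ> \<pi>) i)" using 1 i v(4) by auto
    qed
  qed
qed

lemma iso_list_all2:
  assumes "list_all2 iso ts us"
  shows "iso (Node ts) (Node us)"
  by (rule iso.intros[of _ _ id]) (use assms in \<open>auto simp: list_all2_conv_all_nth permutes_id\<close>)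

lemma iso_mset:
  assumes "mset ts = mset us"
  shows "iso (Node ts) (Node us)"
proof -
  obtain p where p: "p permutes {..<length us}" "permute_list p us = ts"
    using mset_eq_permutation[OF assms] .
  show ?thesis
    by (rule iso.intros[of _ _ p]) (use p in \<open>auto simp: permute_list_nth iso_refl\<close>)
qed

lemma iso_order: "iso t u \<Longrightarrow> order t = order u"
proof (induction rule: iso.induct)
  case (1 ts us \<pi>)
  have "(\<Sum>i<length ts. order (ts ! i)) = (\<Sum>i<length ts. order (us ! \<pi> i))"
    using 1 by (intro sum.cong) auto
  also have "\<dots> = (\<Sum>i<length us. order (us ! i))"
    using sum.permute[OF 1(2), of "\<lambda>i. order (us ! i)"] 1(1) by (simp add: comp_def)
  finally show ?case by (simp add: order_Node_index)
qed

lemma iso_I: "iso t u \<Longrightarrow> I t = I u"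
proof (induction rule: iso.induct)
  case (1 ts us \<pi>)
  have "(\<Sum>i<length ts. I (ts ! i)) = (\<Sum>i<length ts. I (us ! \<pi> i))"
    using 1 by (intro sum.cong) auto
  also have "\<dots> = (\<Sum>i<length us. I (us ! i))"
    using sum.permute[OF 1(2), of "\<lambda>i. I (us ! i)"] 1(1) by (simp add: comp_def)
  finally have s: "(\<Sum>i<length ts. I (ts ! i)) = (\<Sum>i<length us. I (us ! i))" .
  have "(\<Prod>i<length ts. Suc (I (ts ! i))) = (\<Prod>i<length ts. Suc (I (us ! \<pi> i)))"
    using 1 by (intro prod.cong) auto
  also have "\<dots> = (\<Prod>i<length us. Suc (I (us ! i)))"
    using prod.permute[OF 1(2), of "\<lambda>i. Suc (I (us ! i))"] 1(1) by (simp add: comp_def)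
  finally show ?case using s by (simp add: I_Node_index)
qed

lemma iso_minimal: "iso t u \<Longrightarrow> minimal t = minimal u"
  by (simp add: minimal_def iso_I iso_order)

subsection \<open>Root degree of minimal trees\<close>

text \<open>Needed to reason about \<open>Min\<close>; the bound counts all subsets of the
  vertices.\<close>

lemma finite_I_values: "finite {I T | T. order T = n}"
proof (rule finite_subset)
  show "{I T | T. order T = n} \<subseteq> {..2 ^ n}"
  proof
    fix k assume "k \<in> {I T | T. order T = n}"
    then obtain T where T: "k = I T" "order T = n" by blast
    have "card (closed_sets T) \<le> card (Pow (pos T))"
      by (rule card_mono) (auto simp: finite_pos closed_sets_def)
    then show "k \<in> {..2 ^ n}"
      using card_closed_sets[of T] T by (simp add: card_Pow finite_pos order_def)
  qed
qed simp

lemma mn_le: "int (mn (order T)) \<le> val T"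
proof -
  have "mn (order T) \<le> I T" unfolding mn_def by (rule Min_le[OF finite_I_values]) auto
  then show ?thesis by (simp add: val_def)
qed

lemma minimal_exists:
  assumes "1 \<le> n"
  obtains T where "order T = n" "minimal T"
proof -
  have "order (Node (replicate (n - 1) leaf)) = n"
    using assms by (simp add: order_Node order_leaf sum_list_replicate)
  then have "{I T | T. order T = n} \<noteq> {}" by blast
  then have "mn n \<in> {I T | T. order T = n}" unfolding mn_def by (rule Min_in[OF finite_I_values])
  then show thesis using that unfolding minimal_def by auto
qed

definition zval :: "nat \<Rightarrow> int" where
  "zval n = int (mn n) + 2"

lemma zval_le: "zval (order T) \<le> val T + 2"
  using mn_le by (simp add: zval_def)

lemma minimal_iff: "minimal T \<longleftrightarrow> val T + 2 = zval (order T)"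
  by (auto simp: minimal_def zval_def val_def)

lemma minimal_le: "minimal T \<Longrightarrow> order U = order T \<Longrightarrow> val T \<le> val U"
  using mn_le[of U] by (simp add: minimal_iff zval_def)

lemma minimal_perm: "minimal (Node ts) \<Longrightarrow> mset ts = mset us \<Longrightarrow> minimal (Node us)"
  using iso_minimal iso_mset by blast

lemma minimal_hd:
  assumes "minimal (Node (t # ts))"
  shows "minimal t"
proof (rule ccontr)
  assume "\<not> minimal t"
  obtain u where u: "order u = order t" "minimal u" using minimal_exists[OF order_pos] .
  then have "val u < val t"
    using \<open>\<not> minimal t\<close> minimal_le[OF u(2) u(1)[symmetric]] by (auto simp: minimal_iff)
  moreover have "val (Node (t # ts)) \<le> val (Node (u # ts))"
    by (rule minimal_le[OF assms]) (simp add: order_Node u)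
  moreover have "(1 + val u) * (\<Prod>t\<leftarrow>ts. 1 + val t) \<le> (1 + val t) * (\<Prod>t\<leftarrow>ts. 1 + val t)"
    using \<open>val u < val t\<close> prod_val_pos[of ts] by (intro mult_right_mono) auto
  ultimately show False by (simp add: val_Node)
qed

lemma minimal_pair: "minimal (Node [A, B]) \<Longrightarrow> minimal A \<and> minimal B"
  using minimal_hd minimal_perm[of "[A, B]" "[B, A]"] by auto

text \<open>Turning the only child \<open>Node ds\<close> into a leaf next to the trees
  \<open>ds\<close> keeps the order and saves the sum of the values of \<open>ds\<close>.\<close>

lemma minimal_not_one_kid:
  assumes "minimal (Node [t])"
  shows "t = leaf"
proof (rule ccontr)
  assume "t \<noteq> leaf"
  obtain ds where ds: "t = Node ds" "ds \<noteq> []" using \<open>t \<noteq> leaf\<close> by (cases t) (auto simp: leaf_def)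
  have "val (Node [t]) \<le> val (Node (leaf # ds))"
    by (rule minimal_le[OF assms]) (simp add: order_Node ds order_leaf)
  then show False using sum_val_pos[OF ds(2)] by (simp add: val_Node ds val_leaf)
qed

text \<open>Moving a third branch into the cheaper of two branches that are not leaves lowers the count.\<close>

lemma minimal_not_two_inner_aux:
  assumes "minimal (Node (A # B # D # ts))" "A \<noteq> leaf" "val A \<le> val B"
  shows False
proof -
  obtain cs where cs: "A = Node cs" "cs \<noteq> []" using \<open>A \<noteq> leaf\<close> by (cases A) (auto simp: leaf_def)
  define P S Q R where "P = (\<Prod>t\<leftarrow>cs. 1 + val t)" and "S = (\<Sum>t\<leftarrow>cs. val t)"
    and "Q = (\<Prod>t\<leftarrow>ts. 1 + val t)" and "R = (\<Sum>t\<leftarrow>ts. val t)"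
  have A: "val A = P + S" by (simp add: cs val_Node P_def S_def)
  have "val (Node (A # B # D # ts)) \<le> val (Node (Node (D # cs) # B # ts))"
    by (rule minimal_le[OF assms(1)]) (simp add: order_Node cs)
  moreover have "val (Node (A # B # D # ts)) =
      (1 + (P + S)) * ((1 + val B) * ((1 + val D) * Q)) + (P + S + (val B + (val D + R)))"
    unfolding val_Node[of "A # B # D # ts"] by (simp add: A Q_def R_def)
  moreover have "val (Node (Node (D # cs) # B # ts)) =
      (1 + ((1 + val D) * P + (val D + S))) * ((1 + val B) * Q) + ((1 + val D) * P + (val D + S) + (val B + R))"
    unfolding val_Node by (simp add: P_def S_def Q_def R_def val_Node)
  ultimately have "val D * (S * ((1 + val B) * Q) - P) \<le> 0"
    by (simp only: algebra_simps)
  \<comment> \<open>\<open>P + S = val A <= val B\<close> bounds \<open>P\<close>; here the choice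
    of the cheaper branch is used.\<close>
  moreover have "P < S * ((1 + val B) * Q)"
  proof -
    have "1 \<le> S" "1 \<le> Q" using sum_val_pos[OF cs(2)] prod_val_pos[of ts] by (auto simp: S_def Q_def)
    then have "1 * ((1 + val B) * 1) \<le> S * ((1 + val B) * Q)"
      using val_pos[of B] by (intro mult_mono) auto
    then show ?thesis using assms(3) A \<open>1 \<le> S\<close> by simp
  qed
  ultimately show False using val_pos[of D] by (simp add: mult_le_0_iff)
qed

lemma minimal_not_two_inner:
  assumes "minimal (Node (A # B # D # ts))" "A \<noteq> leaf" "B \<noteq> leaf"
  shows False
proof (cases "val A \<le> val B")
  case True
  then show ?thesis using minimal_not_two_inner_aux assms(1,2) by blast
next
  case False
  have "minimal (Node (B # A # D # ts))"
    using assms(1) by (rule minimal_perm) (simp add: add_mset_commute)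
  then show ?thesis using minimal_not_two_inner_aux[of B A D ts] assms(3) False by simp
qed

text \<open>Hanging two of the leaves below the third replaces \<open>8 * Q + 3\<close> by
  \<open>7 * Q + 6\<close>, where \<open>Q\<close> is the product over the remaining
  branches.\<close>

lemma minimal_not_three_leaves:
  assumes "minimal (Node (leaf # leaf # leaf # ts))"
  shows "(\<Prod>t\<leftarrow>ts. 1 + val t) \<le> 3"
proof -
  have "val (Node (leaf # leaf # leaf # ts)) \<le> val (Node (Node [leaf, leaf] # ts))"
    by (rule minimal_le[OF assms]) (simp add: order_Node order_leaf)
  then show ?thesis by (simp add: val_Node val_leaf)
qed

text \<open>With three or more children at most one branch is not a leaf. Next to three leaves the
  other factors multiply to at most 3, which leaves room for one more leaf (factor 2) but not for
  two, nor for an inner branch (factor at least 4).\<close>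

lemma minimal_root:
  assumes "minimal (Node ts)" "3 \<le> order (Node ts)"
  obtains A B where "mset ts = mset [A, B]" | "ts = [leaf, leaf, leaf]" | "ts = [leaf, leaf, leaf, leaf]"
    | B where "mset ts = mset [B, leaf, leaf]" "B \<noteq> leaf"
proof -
  define ns ls where "ns = filter (\<lambda>t. t \<noteq> leaf) ts" and "ls = filter (\<lambda>t. t = leaf) ts"
  define j where "j = length ls"
  have ls: "ls = replicate j leaf"
    unfolding j_def ls_def by (auto simp: replicate_length_same[symmetric])
  have ms: "mset ts = mset (ns @ ls)"
    unfolding ns_def ls_def by (induction ts) auto
  have ns: "\<And>t. t \<in> set ns \<Longrightarrow> t \<noteq> leaf" by (auto simp: ns_def)
  have len: "length ts = length ns + j" using mset_eq_length[OF ms] ls by simp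
  have min: "minimal (Node us)" if "mset us = mset (ns @ ls)" for us
    using minimal_perm[OF assms(1)] ms that by simp
  have len2: "2 \<le> length ts"
  proof (rule ccontr)
    assume "\<not> 2 \<le> length ts"
    then consider "ts = []" | t where "ts = [t]" by (cases ts; cases "tl ts") auto
    then show False
      using assms minimal_not_one_kid[of "hd ts"] by cases (auto simp: order_Node order_leaf)
  qed
  show thesis
  proof (cases "length ts = 2")
    case True
    then obtain A B where "ts = [A, B]" by (cases ts; cases "tl ts") auto
    then show thesis using that(1) by auto
  next
    case False
    then have len3: "3 \<le> length ts" using len2 by simp
    show thesis
    proof (cases ns)
      case Nil
      then have "ls = ts" unfolding ns_def ls_def by (simp add: filter_empty_conv filter_id_conv)
      then have "ts = replicate j leaf" using ls by simp
      moreover have "j \<le> 4"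
      proof (rule ccontr)
        assume "\<not> j \<le> 4"
        then have "\<exists>i. j = Suc (Suc (Suc (Suc (Suc i))))" by presburger
        then obtain i where "j = Suc (Suc (Suc (Suc (Suc i))))" ..
        then have "minimal (Node (leaf # leaf # leaf # (leaf # leaf # replicate i leaf)))"
          using assms(1) \<open>ts = replicate j leaf\<close> by simp
        then have "(\<Prod>t\<leftarrow>leaf # leaf # replicate i leaf. 1 + val t) \<le> 3"
          by (rule minimal_not_three_leaves)
        then have "4 * (\<Prod>t\<leftarrow>replicate i leaf. 1 + val t) \<le> 3" by (simp add: val_leaf)
        then show False using prod_val_pos[of "replicate i leaf"] by linarith
      qed
      ultimately have "ts = [leaf, leaf, leaf] \<or> ts = [leaf, leaf, leaf, leaf]"
      proof -
        have "j = 3 \<or> j = 4" using \<open>j \<le> 4\<close> len3 len Nil by auto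
        then show ?thesis using \<open>ts = replicate j leaf\<close> by (auto simp: numeral_eq_Suc)
      qed
      then show thesis using that by blast
    next
      case (Cons B ns')
      have "ns' = []"
      proof (rule ccontr)
        assume "ns' \<noteq> []"
        then obtain C ns'' where C: "ns' = C # ns''" by (cases ns') auto
        then obtain D us where "ns'' @ ls = D # us" using len3 len Cons ls by (cases "ns'' @ ls") auto
        then have "minimal (Node (B # C # D # us))" using min[of "B # C # D # us"] Cons C by simp
        then show False using minimal_not_two_inner[of B C D us] ns[of B] ns[of C] Cons C by simp
      qed
      moreover have "j = 2"
      proof (rule ccontr)
        assume "j \<noteq> 2"
        have "3 \<le> j" using len3 len Cons \<open>ns' = []\<close> \<open>j \<noteq> 2\<close> by simp
        then have "\<exists>i. j = Suc (Suc (Suc i))" by presburger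
        then obtain i where "j = Suc (Suc (Suc i))" ..
        then have "minimal (Node (leaf # leaf # leaf # B # replicate i leaf))"
          using min[of "leaf # leaf # leaf # B # replicate i leaf"] Cons \<open>ns' = []\<close> ls by simp
        then have "(\<Prod>t\<leftarrow>B # replicate i leaf. 1 + val t) \<le> 3"
          by (rule minimal_not_three_leaves)
        moreover have "4 * 1 \<le> (1 + val B) * (\<Prod>t\<leftarrow>replicate i leaf. 1 + val t)"
          using leaf_or_val_ge[of B] ns[of B] Cons prod_val_pos[of "replicate i leaf"] by (intro mult_mono) auto
        ultimately show False by simp
      qed
      ultimately show thesis using that(4)[of B] ms ls ns Cons by (simp add: numeral_2_eq_2)
    qed
  qed
qed

lemma minimal_root_cases:
  assumes "minimal T" "3 \<le> order T"
  obtains A B where "minimal A" "minimal B" "order B \<le> order A" "order A + order B + 1 = order T"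
      "zval (order T) = zval (order A) * zval (order B) - 1" "iso T (Node [A, B])"
    | "T = star3" | "T = Node [leaf, leaf, leaf, leaf]"
    | B where "minimal B" "B \<noteq> leaf" "order B + 3 = order T"
      "zval (order T) = 5 * zval (order B) - 2" "iso T (Node [B, leaf, leaf])"
proof -
  note outcomes = that
  obtain ts where T: "T = Node ts" by (cases T)
  have pair: thesis if AB: "mset ts = mset [A, B]" "order B \<le> order A" for A B
  proof -
    have iso: "iso T (Node [A, B])" unfolding T using AB(1) by (rule iso_mset)
    then have min: "minimal (Node [A, B])" using assms(1) iso_minimal by blast
    have "zval (order T) = val (Node [A, B]) + 2" using min iso_order[OF iso] by (simp add: minimal_iff)
    then have "zval (order T) = zval (order A) * zval (order B) - 1"
      using minimal_pair[OF min] by (simp add: val_pair minimal_iff)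
    moreover have "order A + order B + 1 = order T" using iso_order[OF iso] by (simp add: order_Node)
    ultimately show thesis using outcomes(1) minimal_pair[OF min] AB(2) iso by blast
  qed
  from minimal_root[OF assms[unfolded T]] show thesis
  proof cases
    case (1 A B)
    then show thesis using pair[of A B] pair[of B A] by (cases "order B \<le> order A") (auto simp: add_mset_commute)
  next
    case 2
    then show thesis using that(2) T by (simp add: star3_def)
  next
    case 3
    then show thesis using that(3) T by simp
  next
    case (4 B)
    have iso: "iso T (Node [B, leaf, leaf])" unfolding T using 4(1) by (rule iso_mset)
    then have min: "minimal (Node [B, leaf, leaf])" using assms(1) iso_minimal by blast
    have "minimal B" using minimal_hd[OF min] .
    have "zval (order T) = val (Node [B, leaf, leaf]) + 2"
      using min iso_order[OF iso] by (simp add: minimal_iff)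
    also have "\<dots> = 5 * zval (order B) - 2"
      using \<open>minimal B\<close> unfolding minimal_iff by (simp add: val_Node val_leaf)
    finally show thesis
      using that(4)[OF \<open>minimal B\<close> 4(2)] iso_order[OF iso] iso by (simp add: order_Node order_leaf)
  qed
qed

section \<open>Monotonicity and the values up to order six\<close>

lemma zval_less_Suc:
  assumes "1 \<le> n"
  shows "zval n < zval (Suc n)"
proof -
  \<comment> \<open>The leaf deleted is the one that ends the leftmost path.\<close>
  have prune: "\<exists>U. order U + 1 = order T \<and> val U < val T" if "2 \<le> order T" for T
    using that
  proof (induction T)
    case (Node ts)
    then obtain t us where ts: "ts = t # us" by (cases ts) (auto simp: order_Node)
    show ?case
    proof (cases "t = leaf")
      case True
      then show ?thesis
        using ts prod_val_pos[of us]
        by (intro exI[of _ "Node us"]) (simp add: order_Node val_Node order_leaf val_leaf)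
    next
      case False
      then have "2 \<le> order t" using order_pos[of t] order_eq_1[of t] by linarith
      then obtain u where u: "order u + 1 = order t" "val u < val t" using Node.IH[of t] ts by auto
      have "(1 + val u) * (\<Prod>t\<leftarrow>us. 1 + val t) \<le> (1 + val t) * (\<Prod>t\<leftarrow>us. 1 + val t)"
        using u prod_val_pos[of us] by (intro mult_right_mono) auto
      then show ?thesis using u ts by (intro exI[of _ "Node (u # us)"]) (simp add: order_Node val_Node)
    qed
  qed
  obtain T where T: "order T = Suc n" "minimal T" using minimal_exists[of "Suc n"] by auto
  then obtain U where "order U = n" "val U < val T" using prune[of T] assms by auto
  then show ?thesis using zval_le[of U] T by (simp add: minimal_iff)
qed

lemma zval_mono: "1 \<le> a \<Longrightarrow> a < b \<Longrightarrow> zval a < zval b"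
proof (induction b)
  case (Suc b)
  then show ?case using zval_less_Suc[of b] by (cases "a = b") (auto simp: less_Suc_eq)
qed simp

lemma zval_pair_le:
  assumes "1 \<le> a" "1 \<le> b"
  shows "zval (a + b + 1) \<le> zval a * zval b - 1"
proof -
  obtain A where A: "order A = a" "minimal A" using minimal_exists[OF assms(1)] .
  obtain B where B: "order B = b" "minimal B" using minimal_exists[OF assms(2)] .
  show ?thesis
    using zval_le[of "Node [A, B]"] A B by (simp add: val_pair order_Node minimal_iff)
qed

lemma zval_1: "zval 1 = 3"
proof -
  obtain T where "order T = 1" "minimal T" using minimal_exists[of 1] by auto
  then show ?thesis using order_eq_1[of T] val_leaf by (simp add: minimal_iff)
qed

lemma zval_2: "zval 2 = 5"
proof -
  obtain T where T: "order T = 2" "minimal T" using minimal_exists[of 2] by auto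
  obtain ts where ts: "T = Node ts" by (cases T)
  then obtain t us where t: "ts = t # us" using T by (cases ts) (auto simp: order_Node)
  have "us = []"
    using T ts t order_pos[of t] order_pos[of "hd us"] by (cases us) (auto simp: order_Node)
  then have "order t = 1" using T ts t by (simp add: order_Node)
  then have "t = leaf" by (simp add: order_eq_1)
  then show ?thesis using T ts t \<open>us = []\<close> by (simp add: minimal_iff val_Node val_leaf)
qed

abbreviation star2 :: tree where "star2 \<equiv> Node [leaf, leaf]"
abbreviation star4 :: tree where "star4 \<equiv> Node [leaf, leaf, leaf, leaf]"

lemma star_simps:
  "order star2 = 3" "val star2 = 6" "order star3 = 4" "val star3 = 11" "order star4 = 5" "val star4 = 20"
  by (simp_all add: star3_def order_Node val_Node order_leaf val_leaf)

lemma minimal_order_3: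
  assumes "minimal T" "order T = 3"
  shows "iso T star2 \<and> zval 3 = 8"
proof -
  have "3 \<le> order T" using assms by simp
  with assms(1) show ?thesis
  proof (cases rule: minimal_root_cases)
    case (1 A B)
    then have "order A = 1" "order B = 1" using assms(2) order_pos[of A] order_pos[of B] by linarith+
    then show ?thesis using 1(5,6) assms(2) zval_1 order_eq_1[of A] order_eq_1[of B] by simp
  next
    case (4 B)
    then show ?thesis using assms(2) order_pos[of B] by simp
  qed (use assms star_simps in auto)
qed

lemma zval_3: "zval 3 = 8"
  using minimal_exists[of 3] minimal_order_3 by (metis one_le_numeral)

lemma minimal_order_4:
  assumes "minimal T" "order T = 4"
  shows "T = star3 \<and> zval 4 = 13"
proof -
  have le: "zval 4 \<le> 13" using zval_le[of star3] by (simp add: star_simps)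
  have "3 \<le> order T" using assms by simp
  with assms(1) show ?thesis
  proof (cases rule: minimal_root_cases)
    case (1 A B)
    then have "order A = 2" "order B = 1" using assms(2) order_pos[of A] order_pos[of B] by linarith+
    then show ?thesis using 1 assms(2) zval_1 zval_2 le by simp
  next
    case 2
    then show ?thesis using assms by (simp add: minimal_iff star_simps)
  next
    case (4 B)
    then show ?thesis using assms(2) order_eq_1[of B] by simp
  qed (use assms star_simps in auto)
qed

lemma zval_4: "zval 4 = 13"
  using minimal_exists[of 4] minimal_order_4 by (metis one_le_numeral)

lemma minimal_order_5:
  assumes "minimal T" "order T = 5"
  shows "T = star4 \<and> zval 5 = 22"
proof -
  have le: "zval 5 \<le> 22" using zval_le[of star4] by (simp add: star_simps)
  have "3 \<le> order T" using assms by simp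
  with assms(1) show ?thesis
  proof (cases rule: minimal_root_cases)
    case (1 A B)
    then have "order A = 3 \<and> order B = 1 \<or> order A = 2 \<and> order B = 2"
      using assms(2) order_pos[of A] order_pos[of B] by linarith
    then show ?thesis using 1 assms(2) zval_1 zval_2 zval_3 le by auto
  next
    case 3
    then show ?thesis using assms star_simps by (simp add: minimal_iff)
  next
    case (4 B)
    then have "order B = 2" using assms(2) by simp
    then show ?thesis using 4 assms(2) zval_2 le by simp
  qed (use assms star_simps in auto)
qed

lemma zval_5: "zval 5 = 22"
  using minimal_exists[of 5] minimal_order_5 by (metis one_le_numeral)

lemma zval_6: "zval 6 = 38"
proof -
  have le: "zval 6 \<le> 38" using zval_pair_le[of 4 1] zval_4 zval_1 by simp
  obtain T where T: "order T = 6" "minimal T" using minimal_exists[of 6] by auto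
  then have "3 \<le> order T" by simp
  with T(2) show ?thesis
  proof (cases rule: minimal_root_cases)
    case (1 A B)
    then have "order A = 4 \<and> order B = 1 \<or> order A = 3 \<and> order B = 2"
      using T order_pos[of A] order_pos[of B] by linarith
    then show ?thesis using 1 T zval_1 zval_2 zval_3 zval_4 le by auto
  next
    case (4 B)
    then have "order B = 3" using T by simp
    then show ?thesis using 4 T zval_3 by simp
  qed (use T star_simps in auto)
qed

lemma zval_ge_2: "2 \<le> n \<Longrightarrow> 5 \<le> zval n"
  using zval_mono[of 2 n] zval_2 by (cases "n = 2") simp_all

text \<open>Every other shape of \<open>B\<close> loses to a tree of the same order. For
  \<open>B = [C, D]\<close> the two leaves move down to \<open>D\<close>; for \<open>star4\<close> a
  pair of orders 4 and 3 gives 103 against 108; for \<open>B = [E, leaf, leaf]\<close> the four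
  leaves are gathered in a \<open>star4\<close> next to \<open>E\<close>.\<close>

lemma minimal_two_leaves_order:
  assumes "minimal T" "7 \<le> order T" "minimal B" "B \<noteq> leaf" "order B + 3 = order T"
    "zval (order T) = 5 * zval (order B) - 2"
  shows "order B = 4"
proof -
  have "3 \<le> order B" using assms by simp
  with assms(3) show ?thesis
  proof (cases rule: minimal_root_cases)
    case (1 C D)
    have "2 \<le> order C" using 1 assms by linarith
    then have C: "5 \<le> zval (order C)" by (rule zval_ge_2)
    have "order (Node [C, Node [D, leaf, leaf]]) = order T"
      using 1 assms by (simp add: order_Node order_leaf)
    then have "zval (order T) \<le> val (Node [C, Node [D, leaf, leaf]]) + 2" by (metis zval_le)
    also have "\<dots> = zval (order C) * (5 * zval (order D) - 2) - 1"
    proof -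
      have "val (Node [D, leaf, leaf]) + 2 = 5 * zval (order D) - 2"
        using \<open>minimal D\<close> unfolding minimal_iff by (simp add: val_Node val_leaf)
      then show ?thesis using \<open>minimal C\<close> unfolding minimal_iff val_pair by simp
    qed
    finally show ?thesis using assms(6) 1(5) C by (simp add: algebra_simps)
  next
    case 3
    then have "order T = 8" using assms star_simps by simp
    then have "zval (order T) \<le> 103" using zval_pair_le[of 4 3] zval_4 zval_3 by simp
    then show ?thesis using assms(6) 3 star_simps zval_5 by simp
  next
    case (4 E)
    have "2 \<le> order E" using 4(2) order_pos[of E] order_eq_1[of E] by linarith
    then have "5 \<le> zval (order E)" by (rule zval_ge_2)
    moreover have order_T: "order T = order E + 5 + 1" using 4(3) assms(5) by simp
    then have "zval (order T) \<le> zval (order E) * 22 - 1"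
      using zval_pair_le[of "order E" 5] order_pos[of E] zval_5 order_T by simp
    ultimately show ?thesis using assms(6) 4(4) by simp
  qed (use star_simps in simp)
qed

lemma minimal_order_ge_7:
  assumes "minimal T" "7 \<le> order T"
  obtains A B where "minimal A" "minimal B" "order B \<le> order A" "order A + order B + 1 = order T"
      "zval (order T) = zval (order A) * zval (order B) - 1" "iso T (Node [A, B])"
    | "order T = 7" "iso T B4'"
proof -
  have "3 \<le> order T" using assms(2) by simp
  with assms(1) show thesis
  proof (cases rule: minimal_root_cases)
    case (4 B)
    then have B: "order B = 4" using minimal_two_leaves_order[OF assms 4(1-4)] by simp
    then have "B = star3" using minimal_order_4 4(1) by simp
    then show thesis using that(2) 4 B by (simp add: B4'_def)
  qed (use assms that(1) star_simps in auto)
qed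

interpretation zval: split_sequence zval
proof
  fix n :: nat
  assume n: "7 \<le> n"
  obtain T where T: "order T = n" "minimal T" using minimal_exists[of n] n by auto
  then have "7 \<le> order T" using n by simp
  with T(2) show "\<exists>a b. 1 \<le> b \<and> b \<le> a \<and> a + b + 1 = n \<and> zval n = zval a * zval b - 1"
  proof (cases rule: minimal_order_ge_7)
    case (1 A B)
    then show ?thesis using T order_pos[of B] by blast
  next
    case 2
    \<comment> \<open>The exceptional root of degree three has value \<open>63 = 8 * 8 - 1\<close>,
      so the recursion for pairs holds at order 7 as well.\<close>
    have "val B4' + 2 = zval 7" using T 2 iso_minimal[OF 2(2)] iso_order[OF 2(2)] by (simp add: minimal_iff)
    then have "zval 7 = zval 3 * zval 3 - 1"
      by (simp add: B4'_def val_Node val_leaf star_simps zval_3)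
    then show ?thesis using 2 T by (intro exI[of _ 3]) simp
  qed
qed (use zval_pair_le zval_mono zval_1 zval_2 zval_3 zval_4 zval_5 zval_6 in auto)

subsection \<open>Minimal trees of order at least seven\<close>

text \<open>The last alternative is the splitting of order 8, whose sum lies below the first scale.
  Order 7 is kept out, since its minimal trees do not all have a root of degree two.\<close>

definition balanced :: "nat \<Rightarrow> nat \<Rightarrow> bool" where
  "balanced a b \<longleftrightarrow> spl a b \<or> spl b a \<or> a = 4 \<and> b = 3"

lemma perfect_mod_5:
  assumes "perfect P"
  obtains m where "P = 5 * m + 4"
proof -
  obtain k where k: "P + 1 = 5 * 2 ^ k" using assms unfolding perfect_def by blast
  have "1 \<le> (2::nat) ^ k" by simp
  then have "P = 5 * (2 ^ k - 1) + 4" using k by linarith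
  then show thesis by (rule that)
qed

text \<open>Both \<open>P\<close> and \<open>2 * P + 1\<close> are 4 modulo 5, while all of
  \<open>P + 1\<close>, \<open>2 * P + 2\<close> and \<open>2 * P - 3\<close> are multiples of
  5.\<close>

lemma spl_mod_5:
  assumes "spl a b"
  shows "a mod 5 = 4 \<or> b mod 5 = 4 \<or> a mod 5 = 0 \<and> b mod 5 = 0"
  using assms
proof (cases rule: splE)
  case (1 P)
  then show ?thesis by (auto elim: perfect_mod_5)
next
  case (2 P)
  obtain m where "P = 5 * m + 4" by (rule perfect_mod_5[OF 2(1)])
  then have "a = 4 + 5 * (2 * m + 1)" using 2(2) by simp
  then show ?thesis by (simp only: mod_mult_self2) simp
next
  case (3 P)
  obtain m where "P = 5 * m + 4" by (rule perfect_mod_5[OF 3(1)])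
  then have "a = 5 * (2 * m + 1)" "b = 5 * (m + 1)" using 3(2,3) by simp_all
  then show ?thesis by simp
next
  case (4 P)
  obtain m where "P = 5 * m + 4" by (rule perfect_mod_5[OF 4(1)])
  then have "a = 5 * (2 * m + 2)" "b = 5 * (2 * m + 1)" using 4(2,3) by simp_all
  then show ?thesis by simp
qed

text \<open>Adding a part of residue 4 and the root does not change residues. Hence residue 2 passes
  to exactly one part, residue 4 passes to both parts, and residue 2 never arises in a part of an
  order without it.\<close>

lemma balanced_mod_5:
  assumes "balanced a b"
  obtains "a mod 5 = 4" "b mod 5 = (a + b + 1) mod 5"
    | "b mod 5 = 4" "a mod 5 = (a + b + 1) mod 5"
    | "a mod 5 = 0" "b mod 5 = 0" "(a + b + 1) mod 5 = 1"
proof -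
  have sum: "(a + b + 1) mod 5 = (a mod 5 + b mod 5 + 1) mod 5" by (metis mod_add_eq mod_add_left_eq)
  have add: "(4 + c mod 5 + 1) mod 5 = c mod 5" for c :: nat
  proof -
    have "(4 + c mod 5 + 1) mod 5 = (c mod 5 + 5) mod 5" by (simp add: add.commute)
    then show ?thesis by simp
  qed
  have "a mod 5 = 4 \<or> b mod 5 = 4 \<or> a mod 5 = 0 \<and> b mod 5 = 0"
    proof -
    from assms consider "spl a b" | "spl b a" | "b = 3" "a = 4" unfolding balanced_def by blast
    then show ?thesis
    proof cases
      case 1
      then show ?thesis by (rule spl_mod_5)
    next
      case 2
      then show ?thesis using spl_mod_5 by blast
    qed simp
  qed
  then show thesis
  proof (elim disjE conjE)
    assume "a mod 5 = 4"
    then show thesis using that(1) sum add[of b] by simp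
  next
    assume "b mod 5 = 4"
    then show thesis using that(2) sum add[of a] by (simp add: add.commute)
  next
    assume "a mod 5 = 0" "b mod 5 = 0"
    then show thesis using that(3) sum by simp
  qed
qed

lemma balanced_ge: "balanced a b \<Longrightarrow> 3 \<le> a \<and> 3 \<le> b \<and> 7 \<le> a + b"
  using spl_sum_ge[of a b] spl_sum_ge[of b a] unfolding balanced_def by auto

lemma zval_opt_exists:
  assumes "7 \<le> n"
  obtains a b where "zval.opt a b" "a + b + 1 = n"
  using zval.z_eq[OF assms] unfolding zval.opt_def by blast

lemma balanced_zval: "balanced a b \<Longrightarrow> zval (a + b + 1) = zval a * zval b - 1"
proof -
  assume "balanced a b"
  moreover have "zval 8 = zval 4 * zval 3 - 1"
  proof -
    obtain a b where ab: "zval.opt a b" "a + b + 1 = 8" using zval_opt_exists[of 8] by auto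
    then have "small_spl a b" using zval.opt_small[of a b] by simp
    then have "a = 4" "b = 3" using ab(2) by (auto simp: small_spl_def)
    then show ?thesis using ab by (simp add: zval.opt_def)
  qed
  moreover have "zval (a + b + 1) = zval a * zval b - 1" if "spl a b" for a b
    using zval.spl_imp_opt[OF that] by (simp add: zval.opt_def)
  ultimately show ?thesis
    unfolding balanced_def by (elim disjE) (simp, metis add.commute mult.commute, simp)
qed

lemma opt_balanced:
  assumes "zval.opt c d" "balanced a b" "c + d = a + b"
  shows "c = a \<and> d = b \<or> c = b \<and> d = a"
proof (cases "a + b = 7")
  case True
  then have "a = 4 \<and> b = 3" using assms(2) spl_sum_ge[of a b] spl_sum_ge[of b a] unfolding balanced_def by auto
  moreover have "small_spl c d" using zval.opt_small[OF assms(1)] assms(3) True by simp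
  ultimately show ?thesis using assms(3) by (auto simp: small_spl_def)
next
  case False
  then have "spl c d" using zval.opt_imp_spl[OF assms(1)] balanced_ge[OF assms(2)] assms(3) by simp
  moreover have "spl a b \<or> spl b a" using False assms(2) unfolding balanced_def by auto
  ultimately show ?thesis using spl_unique[of c d a b] spl_unique[of c d b a] assms(3) by auto
qed

lemma minimal_pairI:
  assumes "balanced a b" "minimal A" "minimal B" "order A = a" "order B = b"
  shows "minimal (Node [A, B])"
  using assms balanced_zval[OF assms(1)] unfolding minimal_iff val_pair by (simp add: order_Node)

lemma minimal_pairD:
  assumes "balanced a b" "minimal T" "order T = a + b + 1"
  obtains A B where "minimal A" "minimal B" "order A = a" "order B = b" "iso T (Node [A, B])"
proof -
  have ge: "7 \<le> a + b" using balanced_ge[OF assms(1)] by simp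
  then have "7 \<le> order T" using assms(3) by simp
  with assms(2) show thesis
  proof (cases rule: minimal_order_ge_7)
    case (1 C D)
    have "zval.opt (order C) (order D)" using 1 order_pos[of D] by (simp add: zval.opt_def)
    then consider "order C = a" "order D = b" | "order C = b" "order D = a"
      using opt_balanced[OF _ assms(1)] 1(4) assms(3) by auto
    then show thesis
    proof cases
      case 1
      then show thesis using that \<open>minimal C\<close> \<open>minimal D\<close> \<open>iso T (Node [C, D])\<close> by blast
    next
      case 2
      have "iso (Node [C, D]) (Node [D, C])" by (rule iso_mset) (simp add: add_mset_commute)
      then show thesis
        using that 2 \<open>minimal C\<close> \<open>minimal D\<close> iso_trans[OF \<open>iso T (Node [C, D])\<close>] by blast
    qed
  next
    case 2
    then show thesis using assms(3) ge by simp
  qed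
qed

section \<open>Canonical trees and their uniqueness\<close>

lemma iso_pair: "iso A C \<Longrightarrow> iso B D \<Longrightarrow> iso (Node [A, B]) (Node [C, D])"
  by (rule iso_list_all2) simp

inductive canon :: "nat \<Rightarrow> tree \<Rightarrow> bool" where
  canon_star2: "canon 3 star2"
| canon_star3: "canon 4 star3"
| canon_star4: "canon 5 star4"
| canon_B4: "canon 7 B4"
| canon_pair: "balanced a b \<Longrightarrow> canon a A \<Longrightarrow> canon b B \<Longrightarrow> canon (a + b + 1) (Node [A, B])"

lemma order_B4: "order B4 = 7" and val_B4: "val B4 = 61"
  and order_B4': "order B4' = 7" and val_B4': "val B4' = 61"
  by (simp_all add: B4_def B4'_def star3_def order_Node val_Node order_leaf val_leaf)

lemma canon_order: "canon n T \<Longrightarrow> order T = n"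
proof (induction rule: canon.induct)
  case (canon_pair a b A B)
  then show ?case by (simp add: order_Node)
qed (simp_all add: star_simps order_B4)

text \<open>The tie behind the exceptional residue class: two stars with two leaves, or
  \<open>star3\<close> with two leaves beside it.\<close>

lemma minimal_7:
  assumes "order T = 7"
  shows "minimal T \<longleftrightarrow> iso T B4 \<or> iso T B4'"
proof -
  obtain a b where ab: "zval.opt a b" "a + b + 1 = 7" using zval_opt_exists[of 7] by auto
  have opt_33: "c = 3 \<and> d = 3" if "zval.opt c d" "c + d = 6" for c d
    using zval.opt_small[OF that(1)] that(2) by (auto simp: small_spl_def)
  have "zval 7 = 63"
    using opt_33[OF ab(1)] ab zval_3 by (auto simp: zval.opt_def)
  then have min: "minimal B4" "minimal B4'"
    by (simp_all add: minimal_iff order_B4 order_B4' val_B4 val_B4')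
  show ?thesis
  proof
    assume "minimal T"
    then show "iso T B4 \<or> iso T B4'"
    proof (cases rule: minimal_order_ge_7)
      case (2 A B)
      have "zval.opt (order A) (order B)" using 2 order_pos[of B] by (simp add: zval.opt_def)
      then have "order A = 3" "order B = 3" using opt_33[of "order A" "order B"] 2(4) assms by auto
      then have "iso (Node [A, B]) B4"
        unfolding B4_def using minimal_order_3 2 by (intro iso_pair) auto
      then show ?thesis using iso_trans 2 by blast
    qed (use assms in auto)
  next
    assume "iso T B4 \<or> iso T B4'"
    then show "minimal T" using iso_minimal min by blast
  qed
qed

lemma canon_minimal: "canon n T \<Longrightarrow> minimal T"
proof (induction rule: canon.induct)
  case canon_B4
  then show ?case using minimal_7[OF order_B4] iso_refl by blast
next
  case (canon_pair a b A B)
  then show ?case using minimal_pairI canon_order by blast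
qed (simp_all add: minimal_iff star_simps zval_3 zval_4 zval_5)

text \<open>No part inherits residue 2, so the recursion never reaches order 7 and ends in stars,
  which are unique.\<close>

lemma minimal_iso_canon:
  "canon n X \<Longrightarrow> n mod 5 \<noteq> 2 \<Longrightarrow> order T = n \<Longrightarrow> minimal T \<Longrightarrow> iso T X"
proof (induction arbitrary: T rule: canon.induct)
  case (canon_pair a b A B)
  from canon_pair(1,8,7) obtain C D where CD: "minimal C" "minimal D" "order C = a" "order D = b"
    "iso T (Node [C, D])" by (rule minimal_pairD)
  have "a mod 5 \<noteq> 2 \<and> b mod 5 \<noteq> 2"
    by (rule balanced_mod_5[OF canon_pair(1)]) (use canon_pair(6) in simp_all)
  then have "iso (Node [C, D]) (Node [A, B])" using CD canon_pair(4,5) by (intro iso_pair) auto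
  then show ?case using iso_trans CD(5) by blast
qed (use minimal_order_3 minimal_order_4 minimal_order_5 iso_refl in auto)

lemma order_sub_le: "p \<in> pos X \<Longrightarrow> order (sub X p) \<le> order X"
proof (induction p arbitrary: X)
  case (Cons i p)
  obtain ts where ts: "X = Node ts" by (cases X)
  then have "i < length ts" "p \<in> pos (ts ! i)" using Cons.prems by (auto simp: pos_def)
  then have "order (sub X (i # p)) \<le> order (ts ! i)" using Cons.IH ts by simp
  also have "\<dots> \<le> order X"
    unfolding ts order_Node using \<open>i < length ts\<close> member_le_sum_list[of "order (ts ! i)" "map order ts"]
    by (simp add: le_Suc_eq)
  finally show ?case .
qed simp

text \<open>Residue 4 passes to both parts, so the recursion ends in copies of \<open>star3\<close>
  only.\<close>

lemma canon_branch_order: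
  "canon n X \<Longrightarrow> n mod 5 = 4 \<Longrightarrow> p \<in> pos X \<Longrightarrow> order (sub X p) \<noteq> 7"
proof (induction arbitrary: p rule: canon.induct)
  case canon_star3
  then show ?case using order_sub_le[of p star3] by (simp add: star_simps)
next
  case (canon_pair a b A B)
  have ab: "a mod 5 = 4 \<and> b mod 5 = 4"
    by (rule balanced_mod_5[OF canon_pair(1)]) (use canon_pair(6) in simp_all)
  have "order (Node [A, B]) \<noteq> 7"
    using canon_order[OF canon_pair(2)] canon_order[OF canon_pair(3)] balanced_ge[OF canon_pair(1)]
    by (simp add: order_Node)
  then show ?case using canon_pair.IH ab canon_pair.prems
    by (cases p) (auto simp: pos_def nth_Cons' less_Suc_eq split: if_splits)
qed auto

lemma Cons_in_pos_pair:
  "j # q \<in> pos (Node [A, B]) \<longleftrightarrow> j = 0 \<and> q \<in> pos A \<or> j = 1 \<and> q \<in> pos B"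
  by (auto simp: pos_def less_Suc_eq)

text \<open>The invariant carried through the induction. Order and minimality of the modified tree
  are included because it becomes a branch of the next larger variant.\<close>

definition variant_at :: "tree \<Rightarrow> nat list \<Rightarrow> bool" where
  "variant_at X p \<longleftrightarrow> p \<in> pos X \<and> iso (sub X p) B4 \<and> (\<forall>q\<in>pos X. iso (sub X q) B4 \<longrightarrow> q = p) \<and>
    order (upd_at p (\<lambda>_. B4') X) = order X \<and> minimal (upd_at p (\<lambda>_. B4') X) \<and>
    (\<forall>T. order T = order X \<longrightarrow> minimal T \<longrightarrow> iso T X \<or> iso T (upd_at p (\<lambda>_. B4') X))"

text \<open>One part has residue 2 and supplies the position; the other has residue 4, so it is
  unique as a minimal tree and contains no branch of order 7.\<close>

lemma canon_variant: "canon n X \<Longrightarrow> n mod 5 = 2 \<Longrightarrow> \<exists>p. variant_at X p"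
proof (induction rule: canon.induct)
  case canon_B4
  have "q = []" if q: "q \<in> pos B4" "iso (sub B4 q) B4" for q
  proof (rule ccontr)
    assume "q \<noteq> []"
    then obtain i p where p: "q = i # p" by (cases q) auto
    then have "kids B4 ! i = star2" "p \<in> pos star2"
      using q(1) by (auto simp: B4_def pos_def nth_Cons' split: if_splits)
    then have "order (sub B4 q) \<le> 3" using order_sub_le[of p star2] p by (simp add: star_simps)
    then show False using iso_order[OF q(2)] by (simp add: order_B4)
  qed
  then have "variant_at B4 []"
    using minimal_7 iso_refl by (auto simp: variant_at_def pos_def order_B4 order_B4')
  then show ?case by blast
next
  case (canon_pair a b A B)
  note ord = canon_order[OF canon_pair(2)] canon_order[OF canon_pair(3)]
  note min = canon_minimal[OF canon_pair(2)] canon_minimal[OF canon_pair(3)]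
  have root: "\<not> iso (Node [A, B]) B4"
    using iso_order[of "Node [A, B]" B4] ord balanced_ge[OF canon_pair(1)] by (auto simp: order_Node order_B4)
  consider "a mod 5 = 2" "b mod 5 = 4" | "a mod 5 = 4" "b mod 5 = 2"
    by (rule balanced_mod_5[OF canon_pair(1)]) (use canon_pair.prems in simp_all)
  then show ?case
  proof cases
    case 1
    then obtain p where p: "variant_at A p" using canon_pair.IH by blast
    define A' where "A' = upd_at p (\<lambda>_. B4') A"
    have A': "order A' = a" "minimal A'" using p ord unfolding variant_at_def A'_def by auto
    have no: "\<not> iso (sub B q) B4" if "q \<in> pos B" for q
      using canon_branch_order[OF canon_pair(3) 1(2) that] iso_order order_B4 by metis
    have others: "iso T (Node [A, B]) \<or> iso T (Node [A', B])"
      if T: "order T = order (Node [A, B])" "minimal T" for T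
    proof -
      have "order T = a + b + 1" using T(1) ord by (simp add: order_Node)
      then obtain C D where CD: "minimal C" "minimal D" "order C = a" "order D = b" "iso T (Node [C, D])"
        by (rule minimal_pairD[OF canon_pair(1) T(2)])
      have "iso D B" using minimal_iso_canon[OF canon_pair(3)] CD 1 by simp
      moreover have "iso C A \<or> iso C A'" using p CD ord unfolding variant_at_def A'_def by auto
      ultimately show ?thesis using iso_trans[OF CD(5)] iso_pair by blast
    qed
    have "variant_at (Node [A, B]) (0 # p)"
      unfolding variant_at_def
    proof (intro conjI ballI allI impI)
      show "0 # p \<in> pos (Node [A, B])" using p by (simp add: variant_at_def Cons_in_pos_pair)
      show "iso (sub (Node [A, B]) (0 # p)) B4" using p by (simp add: variant_at_def)
      show "order (upd_at (0 # p) (\<lambda>_. B4') (Node [A, B])) = order (Node [A, B])"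
        using A'(1) ord by (simp add: order_Node flip: A'_def)
      show "minimal (upd_at (0 # p) (\<lambda>_. B4') (Node [A, B]))"
        using minimal_pairI[OF canon_pair(1)] A' min ord by (simp flip: A'_def)
      show "iso T (Node [A, B]) \<or> iso T (upd_at (0 # p) (\<lambda>_. B4') (Node [A, B]))"
        if "order T = order (Node [A, B])" "minimal T" for T
        using others[OF that] by (simp flip: A'_def)
      fix q assume q: "q \<in> pos (Node [A, B])" "iso (sub (Node [A, B]) q) B4"
      then obtain j q' where q': "q = j # q'" using root by (cases q) auto
      have "j = 0 \<and> q' \<in> pos A"
        using q no[of q'] unfolding q' Cons_in_pos_pair by auto
      then show "q = 0 # p" using p q unfolding q' variant_at_def by simp
    qed
    then show ?thesis by blast
  next
    case 2
    then obtain p where p: "variant_at B p" using canon_pair.IH by blast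
    define B' where "B' = upd_at p (\<lambda>_. B4') B"
    have B': "order B' = b" "minimal B'" using p ord unfolding variant_at_def B'_def by auto
    have no: "\<not> iso (sub A q) B4" if "q \<in> pos A" for q
      using canon_branch_order[OF canon_pair(2) 2(1) that] iso_order order_B4 by metis
    have others: "iso T (Node [A, B]) \<or> iso T (Node [A, B'])"
      if T: "order T = order (Node [A, B])" "minimal T" for T
    proof -
      have "order T = a + b + 1" using T(1) ord by (simp add: order_Node)
      then obtain C D where CD: "minimal C" "minimal D" "order C = a" "order D = b" "iso T (Node [C, D])"
        by (rule minimal_pairD[OF canon_pair(1) T(2)])
      have "iso C A" using minimal_iso_canon[OF canon_pair(2)] CD 2 by simp
      moreover have "iso D B \<or> iso D B'" using p CD ord unfolding variant_at_def B'_def by auto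
      ultimately show ?thesis using iso_trans[OF CD(5)] iso_pair by blast
    qed
    have "variant_at (Node [A, B]) (1 # p)"
      unfolding variant_at_def
    proof (intro conjI ballI allI impI)
      show "1 # p \<in> pos (Node [A, B])" using p by (simp add: variant_at_def Cons_in_pos_pair)
      show "iso (sub (Node [A, B]) (1 # p)) B4" using p by (simp add: variant_at_def)
      show "order (upd_at (1 # p) (\<lambda>_. B4') (Node [A, B])) = order (Node [A, B])"
        using B'(1) ord by (simp add: order_Node flip: B'_def)
      show "minimal (upd_at (1 # p) (\<lambda>_. B4') (Node [A, B]))"
        using minimal_pairI[OF canon_pair(1)] B' min ord by (simp flip: B'_def)
      show "iso T (Node [A, B]) \<or> iso T (upd_at (1 # p) (\<lambda>_. B4') (Node [A, B]))"
        if "order T = order (Node [A, B])" "minimal T" for T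
        using others[OF that] by (simp flip: B'_def)
      fix q assume q: "q \<in> pos (Node [A, B])" "iso (sub (Node [A, B]) q) B4"
      then obtain j q' where q': "q = j # q'" using root by (cases q) auto
      have "j = 1 \<and> q' \<in> pos B"
        using q no[of q'] unfolding q' Cons_in_pos_pair by auto
      then show "q = 1 # p" using p q unfolding q' variant_at_def by simp
    qed
    then show ?thesis by blast
  qed
qed auto

theorem canon_characterisation:
  assumes "canon n X"
  shows "order X = n \<and> minimal X \<and>
    (n mod 5 \<noteq> 2 \<longrightarrow> (\<forall>T. order T = n \<and> minimal T \<longrightarrow> iso T X)) \<and>
    (n mod 5 = 2 \<longrightarrow>
      (\<exists>p. p \<in> pos X \<and> iso (sub X p) B4 \<and>
           (\<forall>q\<in>pos X. iso (sub X q) B4 \<longrightarrow> q = p) \<and>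
           (\<forall>T. order T = n \<longrightarrow>
              (minimal T \<longleftrightarrow> iso T X \<or> iso T (upd_at p (\<lambda>_. B4') X)))))"
proof (intro conjI impI)
  show "order X = n" "minimal X" using canon_order canon_minimal assms by blast+
  show "\<forall>T. order T = n \<and> minimal T \<longrightarrow> iso T X" if "n mod 5 \<noteq> 2"
    using minimal_iso_canon[OF assms that] by blast
  assume "n mod 5 = 2"
  then obtain p where p: "variant_at X p" using canon_variant[OF assms] by blast
  have "minimal T \<longleftrightarrow> iso T X \<or> iso T (upd_at p (\<lambda>_. B4') X)" if "order T = n" for T
  proof
    assume "minimal T"
    then show "iso T X \<or> iso T (upd_at p (\<lambda>_. B4') X)"
      using p that \<open>order X = n\<close> unfolding variant_at_def by simp
  next
    assume "iso T X \<or> iso T (upd_at p (\<lambda>_. B4') X)"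
    then show "minimal T"
      using p \<open>minimal X\<close> iso_minimal[of T] unfolding variant_at_def by auto
  qed
  with p show "\<exists>p. p \<in> pos X \<and> iso (sub X p) B4 \<and> (\<forall>q\<in>pos X. iso (sub X q) B4 \<longrightarrow> q = p) \<and>
      (\<forall>T. order T = n \<longrightarrow> (minimal T \<longleftrightarrow> iso T X \<or> iso T (upd_at p (\<lambda>_. B4') X)))"
    unfolding variant_at_def by (intro exI[of _ p]) simp
qed

subsection \<open>Filled complete binary trees\<close>

abbreviation B2_minus :: tree where "B2_minus \<equiv> Node [star3, star2]"
abbreviation B2_plus :: tree where "B2_plus \<equiv> Node [star4, star3]"
abbreviation B2_plus2 :: tree where "B2_plus2 \<equiv> Node [star4, star4]"

text \<open>
  With $m = 2^k + p$ and $q = 2^k - p$, these lists of leaf replacements produce $T_n$ for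
  $n = 5m - 1$, for $n = 5m - 2$ or $n = 5m - 3$ depending on $B$, for $n = 5m$ and for
  $n = 5m + 1$.
\<close>

definition fill :: "nat \<Rightarrow> nat \<Rightarrow> tree list" where
  "fill p q = replicate p B2 @ replicate q star3"

definition fill_minus :: "tree \<Rightarrow> nat \<Rightarrow> nat \<Rightarrow> tree list" where
  "fill_minus B p q = replicate (p - 1) B2 @ B # replicate q star3"

definition fill_plus :: "nat \<Rightarrow> nat \<Rightarrow> tree list" where
  "fill_plus p q = (if q = 0 then B2_plus # replicate (p - 1) B2
     else replicate p B2 @ star4 # replicate (q - 1) star3)"

definition fill_plus2 :: "nat \<Rightarrow> nat \<Rightarrow> tree list" where
  "fill_plus2 p q = (if q = 0 then B2_plus2 # replicate (p - 1) B2
     else if q = 1 then B2_plus # replicate (p - 1) B2 @ [star4]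
     else replicate p B2 @ star4 # star4 # replicate (q - 2) star3)"

lemma balanced_perfect_right:
  assumes "P + 1 = 5 * 2 ^ k" "P \<le> a" "a \<le> 2 * P + 1" "a + 2 \<noteq> 2 * P"
  shows "balanced a P"
  using assms unfolding balanced_def spl_def perfect_def by blast

lemma balanced_perfect_left:
  assumes "P + 1 = 5 * 2 ^ k" "P \<le> b" "b \<le> 2 * P + 1" "b + 2 \<noteq> 2 * P"
  shows "balanced (2 * P + 1) b"
  using assms unfolding balanced_def spl_def perfect_def by blast

lemma balanced_exceptional_low:
  assumes "P + 1 = 5 * 2 ^ k" "a + 3 = 2 * P"
  shows "balanced a (P + 1)"
  using assms unfolding balanced_def spl_def perfect_def by blast

lemma balanced_exceptional_high:
  assumes "P + 1 = 5 * 2 ^ k" "b + 3 = 2 * P"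
  shows "balanced (2 * P + 2) b"
  using assms unfolding balanced_def spl_def perfect_def by blast

text \<open>Modulo 5 the excluded value \<open>2 * P - 2\<close> is 1, whereas \<open>a\<close> is
  0, 4, 3 or 2. Only orders \<open>5 * m + 1\<close> can meet the exceptional splittings.\<close>

lemma avoid_exception:
  fixes a P :: nat
  assumes "P + 1 = 5 * K" "a + d = 5 * x" "d \<le> 3"
  shows "a + 2 \<noteq> 2 * P"
proof
  assume "a + 2 = 2 * P"
  then have "5 * x + 4 = 10 * K + d" using assms by linarith
  then show False using assms(3) by (cases "x < 2 * K") linarith+
qed

lemma canon_cbt_Suc:
  assumes "canon a (cbt k us)" "canon b (cbt k vs)" "length us = 2 ^ k" "balanced a b" "n = a + b + 1"
  shows "canon n (cbt (Suc k) (us @ vs))"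
  using canon_pair[OF assms(4,1,2)] assms(3,5) by simp

lemma length_fill: "length (fill p q) = p + q"
  by (simp add: fill_def)

lemma length_fill_minus: "1 \<le> p \<Longrightarrow> length (fill_minus B p q) = p + q"
  by (simp add: fill_minus_def)

lemma length_fill_plus: "1 \<le> p + q \<Longrightarrow> length (fill_plus p q) = p + q"
  by (auto simp: fill_plus_def)

lemma length_fill_plus2: "2 \<le> p + q \<or> 1 \<le> p \<Longrightarrow> length (fill_plus2 p q) = p + q"
  by (auto simp: fill_plus2_def)

text \<open>Here and below, with \<open>K = 2 ^ k\<close>, the list is cut into the replacements for
  the two halves of the tree. As long as the \<open>B2\<close> blocks fit into the left half, the
  right half consists of \<open>star3\<close>; beyond that the left half consists of
  \<open>B2\<close>. This mirrors the first two lines of \<open>spl\<close>.\<close>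

lemma fill_left:
  assumes "p \<le> K"
  shows "fill p (2 * K - p) = fill p (K - p) @ fill 0 K"
proof -
  have "2 * K - p = (K - p) + K" using assms by simp
  then show ?thesis unfolding fill_def by (simp only: replicate_add) simp
qed

lemma fill_right:
  assumes "K \<le> p" "p \<le> 2 * K"
  shows "fill p (2 * K - p) = fill K 0 @ fill (p - K) (K - (p - K))"
proof -
  obtain r where r: "p = K + r" using assms(1) le_Suc_ex by blast
  then have "2 * K - p = K - r" by simp
  then show ?thesis unfolding fill_def r by (simp add: replicate_add)
qed

lemma fill_minus_left:
  assumes "p \<le> K"
  shows "fill_minus B p (2 * K - p) = fill_minus B p (K - p) @ fill 0 K"
proof -
  have "2 * K - p = (K - p) + K" using assms by simp
  then show ?thesis unfolding fill_minus_def fill_def by (simp only: replicate_add) simp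
qed

lemma fill_minus_right:
  assumes "K < p" "p \<le> 2 * K"
  shows "fill_minus B p (2 * K - p) = fill K 0 @ fill_minus B (p - K) (K - (p - K))"
proof -
  obtain r where r: "p = K + Suc r" using assms(1) less_imp_Suc_add by auto
  then have "2 * K - p = K - Suc r" by simp
  then show ?thesis unfolding fill_minus_def fill_def r by (simp add: replicate_add)
qed

lemma fill_plus_left:
  assumes "p < K"
  shows "fill_plus p (2 * K - p) = fill_plus p (K - p) @ fill 0 K"
proof -
  obtain r where r: "K - p = Suc r" using assms by (metis Suc_diff_Suc)
  then have "2 * K - p = Suc (r + K)" using assms by simp
  then show ?thesis unfolding fill_plus_def fill_def r by (simp add: replicate_add)
qed

lemma fill_plus_right:
  assumes "K \<le> p" "p < 2 * K"
  shows "fill_plus p (2 * K - p) = fill K 0 @ fill_plus (p - K) (K - (p - K))"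
proof -
  obtain r where r: "p = K + r" using assms(1) le_Suc_ex by blast
  then have "2 * K - p = K - r" "r < K" using assms by simp_all
  then show ?thesis unfolding fill_plus_def fill_def r by (simp add: replicate_add)
qed

text \<open>Once no \<open>star3\<close> is left, the first vertex with leaf children lies in the
  left half, so the surplus leaf changes sides.\<close>

lemma fill_plus_full:
  assumes "1 \<le> K"
  shows "fill_plus (2 * K) 0 = fill_plus K 0 @ fill K 0"
proof -
  obtain r where r: "K = Suc r" using assms by (cases K) auto
  have "2 * Suc r - 1 = r + Suc r" by simp
  then show ?thesis unfolding fill_plus_def fill_def r by (simp only: replicate_add) simp
qed

lemma fill_plus2_left:
  assumes "p + 2 \<le> K"
  shows "fill_plus2 p (2 * K - p) = fill_plus2 p (K - p) @ fill 0 K"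
proof -
  obtain r where r: "K = p + 2 + r" using assms le_Suc_ex by blast
  then have "2 * K - p = Suc (Suc (r + K))" "K - p = Suc (Suc r)" by simp_all
  then show ?thesis unfolding fill_plus2_def fill_def by (simp add: replicate_add)
qed

text \<open>The left half holds a single \<open>star3\<close>, so the second surplus leaf goes to
  the right half. This is the exceptional splitting into \<open>2 * P - 3\<close> and
  \<open>P + 1\<close>.\<close>

lemma fill_plus2_left1:
  assumes "p + 1 = K"
  shows "fill_plus2 p (2 * K - p) = fill_plus p (K - p) @ fill_plus 0 K"
proof -
  have "2 * K - p = Suc (Suc p)" "K - p = 1" using assms by simp_all
  then show ?thesis unfolding fill_plus2_def fill_plus_def using assms by auto
qed

lemma fill_plus2_right:
  assumes "K \<le> p" "p + 2 \<le> 2 * K"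
  shows "fill_plus2 p (2 * K - p) = fill K 0 @ fill_plus2 (p - K) (K - (p - K))"
proof -
  obtain r where r: "p = K + r" using assms(1) le_Suc_ex by blast
  then have "2 * K - p = K - r" "\<not> K \<le> r" "K - r \<noteq> Suc 0" using assms by simp_all
  then show ?thesis unfolding fill_plus2_def fill_def r by (simp add: replicate_add)
qed

text \<open>The only \<open>star3\<close> is the last block; the second surplus leaf goes one level
  deeper, to the very first block. This is the exceptional splitting into \<open>2 * P + 2\<close>
  and \<open>2 * P - 3\<close>.\<close>

lemma fill_plus2_right1:
  assumes "p + 1 = 2 * K"
  shows "fill_plus2 p (2 * K - p) = fill_plus K 0 @ fill_plus (p - K) (K - (p - K))"
proof -
  obtain r where r: "K = Suc r" using assms by (cases K) auto
  have "p - 1 = r + r" "2 * K - p = 1" "p - K = r" "K - r = 1" using assms r by simp_all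
  then show ?thesis unfolding fill_plus2_def fill_plus_def by (simp add: replicate_add r)
qed

lemma fill_plus2_full:
  assumes "1 \<le> K"
  shows "fill_plus2 (2 * K) 0 = fill_plus2 K 0 @ fill K 0"
proof -
  obtain r where r: "K = Suc r" using assms by (cases K) auto
  have "2 * Suc r - 1 = r + Suc r" by simp
  then show ?thesis unfolding fill_plus2_def fill_def r by (simp only: replicate_add) simp
qed

lemma balanced_small: "balanced 4 4" "balanced 5 4" "balanced 5 5" "balanced 4 3"
  using balanced_perfect_right[of 4 0 4] balanced_perfect_right[of 4 0 5] balanced_exceptional_low[of 4 0 5]
  by (simp_all add: balanced_def)

text \<open>With \<open>P + 1 = 5 * K\<close>, a half filled with \<open>star3\<close> has order
  \<open>P\<close> and a half filled with \<open>B2\<close> has order \<open>2 * P + 1\<close>. The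
  induction hypothesis supplies the other half.\<close>

lemma canon_fill: "p \<le> 2 ^ k \<Longrightarrow> n + 1 = 5 * (2 ^ k + p) \<Longrightarrow> canon n (cbt k (fill p (2 ^ k - p)))"
proof (induction k arbitrary: p n)
  case 0
  then have "p = 0 \<and> n = 4 \<or> p = 1 \<and> n = 9" by auto
  then show ?case
    using canon_star3 canon_pair[OF balanced_small(1) canon_star3 canon_star3]
    by (auto simp: fill_def B2_def)
next
  case (Suc k)
  define K P :: nat where "K = 2 ^ k" and "P = 5 * K - 1"
  have "1 \<le> K" by (simp add: K_def)
  then have P: "P + 1 = 5 * K" "P + 1 = 5 * 2 ^ k" by (simp_all add: P_def K_def)
  note IH = Suc.IH[folded K_def]
  have n: "n + 1 = 5 * (2 * K + p)" "p \<le> 2 * K" using Suc.prems by (simp_all add: K_def)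
  show ?case
  proof (cases "p \<le> K")
    case True
    define a where "a = 5 * (K + p) - 1"
    have a: "a + 1 = 5 * (K + p)" using \<open>1 \<le> K\<close> by (simp add: a_def)
    have "canon n (cbt (Suc k) (fill p (K - p) @ fill 0 K))"
    proof (rule canon_cbt_Suc)
      show "canon a (cbt k (fill p (K - p)))" using True a by (intro IH) auto
      show "canon P (cbt k (fill 0 K))" using IH[of 0 P] P by simp
      show "length (fill p (K - p)) = 2 ^ k" using True by (simp add: length_fill K_def)
      show "balanced a P"
        by (rule balanced_perfect_right[OF P(2) _ _ avoid_exception[OF P(1) a]]) (use True P(1) a in simp)+
      show "n = a + P + 1" using n P(1) a by simp
    qed
    then show ?thesis using fill_left[OF True] by (simp add: K_def)
  next
    case False
    then have p: "K \<le> p" by simp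
    define b where "b = 5 * p - 1"
    have b: "b + 1 = 5 * p" using \<open>1 \<le> K\<close> p by (simp add: b_def)
    have "canon n (cbt (Suc k) (fill K 0 @ fill (p - K) (K - (p - K))))"
    proof (rule canon_cbt_Suc)
      show "canon (2 * P + 1) (cbt k (fill K 0))" using IH[of K "2 * P + 1"] P by simp
      show "canon b (cbt k (fill (p - K) (K - (p - K))))" using p n b by (intro IH) auto
      show "length (fill K 0) = 2 ^ k" by (simp add: length_fill K_def)
      show "balanced (2 * P + 1) b"
        by (rule balanced_perfect_left[OF P(2) _ _ avoid_exception[OF P(1) b]]) (use p n(2) P(1) b in simp)+
      show "n = 2 * P + 1 + b + 1" using n P(1) b by simp
    qed
    then show ?thesis using fill_right[OF p n(2)] by (simp add: K_def)
  qed
qed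

lemma canon_fill_minus:
  assumes "d = 2 \<and> B = B2_minus \<or> d = 3 \<and> B = B4"
  shows "1 \<le> p \<Longrightarrow> p \<le> 2 ^ k \<Longrightarrow> n + d = 5 * (2 ^ k + p) \<Longrightarrow> canon n (cbt k (fill_minus B p (2 ^ k - p)))"
proof (induction k arbitrary: p n)
  case 0
  then have "p = 1 \<and> n + d = 10" by auto
  then show ?case
    using canon_B4 canon_pair[OF balanced_small(4) canon_star3 canon_star2] assms
    by (auto simp: fill_minus_def)
next
  case (Suc k)
  define K P :: nat where "K = 2 ^ k" and "P = 5 * K - 1"
  have "1 \<le> K" by (simp add: K_def)
  then have P: "P + 1 = 5 * K" "P + 1 = 5 * 2 ^ k" by (simp_all add: P_def K_def)
  note IH = Suc.IH[folded K_def]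
  have n: "n + d = 5 * (2 * K + p)" "1 \<le> p" "p \<le> 2 * K" using Suc.prems by (simp_all add: K_def)
  have d: "2 \<le> d" "d \<le> 3" using assms by auto
  show ?case
  proof (cases "p \<le> K")
    case True
    define a where "a = 5 * (K + p) - d"
    have a: "a + d = 5 * (K + p)" using \<open>1 \<le> K\<close> d by (auto simp: a_def)
    have "canon n (cbt (Suc k) (fill_minus B p (K - p) @ fill 0 K))"
    proof (rule canon_cbt_Suc)
      show "canon a (cbt k (fill_minus B p (K - p)))" using True n a by (intro IH) auto
      show "canon P (cbt k (fill 0 K))" using canon_fill[of 0 k P] P by (simp add: K_def)
      show "length (fill_minus B p (K - p)) = 2 ^ k" using True n by (simp add: length_fill_minus K_def)
      show "balanced a P"
        by (rule balanced_perfect_right[OF P(2) _ _ avoid_exception[OF P(1) a]]) (use True n(2) P(1) a d in simp)+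
      show "n = a + P + 1" using n P(1) a by simp
    qed
    then show ?thesis using fill_minus_left[OF True] by (simp add: K_def)
  next
    case False
    then have p: "K < p" by simp
    define b where "b = 5 * p - d"
    have b: "b + d = 5 * p" using n(2) d by (auto simp: b_def)
    have "canon n (cbt (Suc k) (fill K 0 @ fill_minus B (p - K) (K - (p - K))))"
    proof (rule canon_cbt_Suc)
      show "canon (2 * P + 1) (cbt k (fill K 0))" using canon_fill[of K k "2 * P + 1"] P by (simp add: K_def)
      show "canon b (cbt k (fill_minus B (p - K) (K - (p - K))))" using p n b by (intro IH) auto
      show "length (fill K 0) = 2 ^ k" by (simp add: length_fill K_def)
      show "balanced (2 * P + 1) b"
        by (rule balanced_perfect_left[OF P(2) _ _ avoid_exception[OF P(1) b]]) (use p n(3) P(1) b d in simp)+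
      show "n = 2 * P + 1 + b + 1" using n P(1) b by simp
    qed
    then show ?thesis using fill_minus_right[OF p n(3)] by (simp add: K_def)
  qed
qed

lemma canon_fill_plus: "p \<le> 2 ^ k \<Longrightarrow> n = 5 * (2 ^ k + p) \<Longrightarrow> canon n (cbt k (fill_plus p (2 ^ k - p)))"
proof (induction k arbitrary: p n)
  case 0
  then have "p = 0 \<and> n = 5 \<or> p = 1 \<and> n = 10" by auto
  then show ?case
    using canon_star4 canon_pair[OF balanced_small(2) canon_star4 canon_star3]
    by (auto simp: fill_plus_def)
next
  case (Suc k)
  define K P :: nat where "K = 2 ^ k" and "P = 5 * K - 1"
  have "1 \<le> K" by (simp add: K_def)
  then have "P + 1 = 5 * K" by (simp add: P_def)
  then have P: "P + 1 = 5 * K" "P + 1 = 5 * 2 ^ k" "2 * P + 1 + 1 = 5 * 2 ^ Suc k" by (simp_all add: K_def)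
  note IH = Suc.IH[folded K_def]
  have n: "n = 5 * (2 * K + p)" "p \<le> 2 * K" using Suc.prems by (simp_all add: K_def)
  consider "p < K" | "K \<le> p" "p < 2 * K" | "p = 2 * K" using n(2) by linarith
  then show ?case
  proof cases
    case 1
    have "canon n (cbt (Suc k) (fill_plus p (K - p) @ fill 0 K))"
    proof (rule canon_cbt_Suc)
      show "canon (5 * (K + p)) (cbt k (fill_plus p (K - p)))" using 1 by (intro IH) auto
      show "canon P (cbt k (fill 0 K))" using canon_fill[of 0 k P] P by (simp add: K_def)
      show "length (fill_plus p (K - p)) = 2 ^ k" using 1 by (simp add: length_fill_plus K_def)
      show "balanced (5 * (K + p)) P"
        by (rule balanced_perfect_right[OF P(2) _ _ avoid_exception[OF P(1), of _ 0 "K + p"]]) (use 1 P(1) in simp_all)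
      show "n = 5 * (K + p) + P + 1" using n P by simp
    qed
    then show ?thesis using fill_plus_left[OF 1] by (simp add: K_def)
  next
    case 2
    have "canon n (cbt (Suc k) (fill K 0 @ fill_plus (p - K) (K - (p - K))))"
    proof (rule canon_cbt_Suc)
      show "canon (2 * P + 1) (cbt k (fill K 0))" using canon_fill[of K k "2 * P + 1"] P by (simp add: K_def)
      show "canon (5 * p) (cbt k (fill_plus (p - K) (K - (p - K))))" using 2 by (intro IH) auto
      show "length (fill K 0) = 2 ^ k" by (simp add: length_fill K_def)
      show "balanced (2 * P + 1) (5 * p)"
        by (rule balanced_perfect_left[OF P(2) _ _ avoid_exception[OF P(1), of _ 0 p]]) (use 2 P(1) in simp_all)
      show "n = 2 * P + 1 + 5 * p + 1" using n P by simp
    qed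
    then show ?thesis using fill_plus_right[OF 2] by (simp add: K_def)
  next
    case 3
    have "canon n (cbt (Suc k) (fill_plus K 0 @ fill K 0))"
    proof (rule canon_cbt_Suc)
      show "canon (10 * K) (cbt k (fill_plus K 0))" using IH[of K "10 * K"] by simp
      show "canon (2 * P + 1) (cbt k (fill K 0))" using canon_fill[of K k "2 * P + 1"] P by (simp add: K_def)
      show "length (fill_plus K 0) = 2 ^ k" using \<open>1 \<le> K\<close> by (simp add: length_fill_plus K_def)
      \<comment> \<open>The halves are nearly equal, so the sum belongs to the next scale,
        \<open>2 * P + 1\<close>.\<close>
      show "balanced (10 * K) (2 * P + 1)"
        by (rule balanced_perfect_right[of _ "Suc k"]) (rule P(3), (use P(1) \<open>1 \<le> K\<close> in arith)+)
      show "n = 10 * K + (2 * P + 1) + 1" using n P 3 by simp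
    qed
    then show ?thesis using fill_plus_full[OF \<open>1 \<le> K\<close>] 3 by (simp add: K_def)
  qed
qed

lemma canon_fill_plus2:
  "p \<le> 2 ^ k \<Longrightarrow> 2 \<le> 2 ^ k + p \<Longrightarrow> n = 5 * (2 ^ k + p) + 1 \<Longrightarrow> canon n (cbt k (fill_plus2 p (2 ^ k - p)))"
proof (induction k arbitrary: p n)
  case 0
  then have "p = 1 \<and> n = 11" by auto
  then show ?case
    using canon_pair[OF balanced_small(3) canon_star4 canon_star4]
    by (auto simp: fill_plus2_def)
next
  case (Suc k)
  define K P :: nat where "K = 2 ^ k" and "P = 5 * K - 1"
  have "1 \<le> K" by (simp add: K_def)
  then have "P + 1 = 5 * K" by (simp add: P_def)
  then have P: "P + 1 = 5 * K" "P + 1 = 5 * 2 ^ k" "2 * P + 1 + 1 = 5 * 2 ^ Suc k" by (simp_all add: K_def)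
  note IH = Suc.IH[folded K_def]
  have n: "n = 5 * (2 * K + p) + 1" "p \<le> 2 * K" using Suc.prems by (simp_all add: K_def)
  consider "p + 2 \<le> K" | "p + 1 = K" | "K \<le> p" "p + 2 \<le> 2 * K" | "p + 1 = 2 * K" | "p = 2 * K"
    using n(2) by linarith
  then show ?case
  proof cases
    case 1
    have "canon n (cbt (Suc k) (fill_plus2 p (K - p) @ fill 0 K))"
    proof (rule canon_cbt_Suc)
      show "canon (5 * (K + p) + 1) (cbt k (fill_plus2 p (K - p)))" using 1 by (intro IH) auto
      show "canon P (cbt k (fill 0 K))" using canon_fill[of 0 k P] P by (simp add: K_def)
      show "length (fill_plus2 p (K - p)) = 2 ^ k" using 1 by (simp add: length_fill_plus2 K_def)
      show "balanced (5 * (K + p) + 1) P" 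
        by (rule balanced_perfect_right[OF P(2)]) (use 1 P(1) in simp)+
      show "n = 5 * (K + p) + 1 + P + 1" using n P by simp
    qed
    then show ?thesis using fill_plus2_left[OF 1] by (simp add: K_def)
  next
    case 2
    have "canon n (cbt (Suc k) (fill_plus p (K - p) @ fill_plus 0 K))"
    proof (rule canon_cbt_Suc)
      show "canon (5 * (K + p)) (cbt k (fill_plus p (K - p)))"
        using canon_fill_plus[of p k] 2 by (simp add: K_def)
      show "canon (P + 1) (cbt k (fill_plus 0 K))" using canon_fill_plus[of 0 k "P + 1"] P by (simp add: K_def)
      show "length (fill_plus p (K - p)) = 2 ^ k" using 2 by (simp add: length_fill_plus K_def)
      show "balanced (5 * (K + p)) (P + 1)" 
        by (rule balanced_exceptional_low[OF P(2)]) (use 2 P(1) in simp)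
      show "n = 5 * (K + p) + (P + 1) + 1" using n P by simp
    qed
    then show ?thesis using fill_plus2_left1[OF 2] by (simp add: K_def)
  next
    case 3
    have "canon n (cbt (Suc k) (fill K 0 @ fill_plus2 (p - K) (K - (p - K))))"
    proof (rule canon_cbt_Suc)
      show "canon (2 * P + 1) (cbt k (fill K 0))" using canon_fill[of K k "2 * P + 1"] P by (simp add: K_def)
      show "canon (5 * p + 1) (cbt k (fill_plus2 (p - K) (K - (p - K))))" using 3 by (intro IH) auto
      show "length (fill K 0) = 2 ^ k" by (simp add: length_fill K_def)
      show "balanced (2 * P + 1) (5 * p + 1)" 
        by (rule balanced_perfect_left[OF P(2)]) (use 3 P(1) in simp)+
      show "n = 2 * P + 1 + (5 * p + 1) + 1" using n P by simp
    qed
    then show ?thesis using fill_plus2_right[OF 3] by (simp add: K_def)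
  next
    case 4
    have "canon n (cbt (Suc k) (fill_plus K 0 @ fill_plus (p - K) (K - (p - K))))"
    proof (rule canon_cbt_Suc)
      show "canon (2 * P + 2) (cbt k (fill_plus K 0))" using canon_fill_plus[of K k "2 * P + 2"] P by (simp add: K_def)
      show "canon (5 * p) (cbt k (fill_plus (p - K) (K - (p - K))))"
        using canon_fill_plus[of "p - K" k "5 * p", folded K_def] 4 \<open>1 \<le> K\<close> by simp
      show "length (fill_plus K 0) = 2 ^ k" using \<open>1 \<le> K\<close> by (simp add: length_fill_plus K_def)
      show "balanced (2 * P + 2) (5 * p)" 
        by (rule balanced_exceptional_high[OF P(2)]) (use 4 P(1) in simp)
      show "n = 2 * P + 2 + 5 * p + 1" using n P by simp
    qed
    then show ?thesis using fill_plus2_right1[OF 4] by (simp add: K_def)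
  next
    case 5
    have "canon n (cbt (Suc k) (fill_plus2 K 0 @ fill K 0))"
    proof (rule canon_cbt_Suc)
      show "canon (10 * K + 1) (cbt k (fill_plus2 K 0))" using IH[of K "10 * K + 1"] \<open>1 \<le> K\<close> by simp
      show "canon (2 * P + 1) (cbt k (fill K 0))" using canon_fill[of K k "2 * P + 1"] P by (simp add: K_def)
      show "length (fill_plus2 K 0) = 2 ^ k" using \<open>1 \<le> K\<close> by (simp add: length_fill_plus2 K_def)
      show "balanced (10 * K + 1) (2 * P + 1)"
        by (rule balanced_perfect_right[of _ "Suc k"]) (rule P(3), (use P(1) \<open>1 \<le> K\<close> in arith)+)
      show "n = 10 * K + 1 + (2 * P + 1) + 1" using n P 5 by simp
    qed
    then show ?thesis using fill_plus2_full[OF \<open>1 \<le> K\<close>] 5 by (simp add: K_def)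
  qed
qed

subsection \<open>The trees of the theorem\<close>

text \<open>The path to leaf number \<open>i\<close> is the binary expansion of \<open>i\<close> in
  \<open>k\<close> digits, most significant digit first.\<close>

primrec bin :: "nat \<Rightarrow> nat \<Rightarrow> nat list" where
  "bin 0 i = []"
| "bin (Suc k) i = (if i < 2 ^ k then 0 # bin k i else 1 # bin k (i - 2 ^ k))"

lemma length_bin: "length (bin k i) = k"
  by (induction k arbitrary: i) auto

lemma bin_less: "i < j \<Longrightarrow> j < 2 ^ k \<Longrightarrow> bin k i @ s < bin k j @ u"
proof (induction k arbitrary: i j)
  case (Suc k)
  show ?case
  proof (cases "i < 2 ^ k \<and> \<not> j < 2 ^ k")
    case False
    then show ?thesis using Suc by auto
  qed simp
qed simp

lemma bin_append_less: "s < u \<Longrightarrow> bin k i @ s < bin k i @ u"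
  by (induction k arbitrary: i) auto

lemma upd_at_cbt:
  "length ts = 2 ^ k \<Longrightarrow> i < 2 ^ k \<Longrightarrow>
    upd_at (bin k i @ s) f (cbt k ts) = cbt k (ts[i := upd_at s f (ts ! i)])"
proof (induction k arbitrary: i ts)
  case 0
  then show ?case by (cases ts) auto
next
  case (Suc k)
  show ?case
  proof (cases "i < 2 ^ k")
    case True
    then show ?thesis
      using Suc.IH[of "take (2 ^ k) ts" i] Suc.prems by (simp add: take_update_swap)
  next
    case False
    then show ?thesis
      using Suc.IH[of "drop (2 ^ k) ts" "i - 2 ^ k"] Suc.prems
      by (simp add: drop_update_swap)
  qed
qed

lemma cbt_not_leaf: "length ts = 2 ^ k \<Longrightarrow> leaf \<notin> set ts \<Longrightarrow> cbt k ts \<noteq> leaf"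
proof (cases k)
  case 0
  then show "length ts = 2 ^ k \<Longrightarrow> leaf \<notin> set ts \<Longrightarrow> cbt k ts \<noteq> leaf" by (cases ts) auto
qed (simp add: leaf_def)

text \<open>The condition on \<open>Q\<close> excludes the inner vertices of the complete binary
  tree, so every vertex found lies inside a block. It holds both for childless vertices and for
  vertices with a leaf child.\<close>

lemma branches_cbt:
  assumes inner: "\<And>A B. A \<noteq> leaf \<Longrightarrow> B \<noteq> leaf \<Longrightarrow> \<not> Q (Node [A, B])"
    and "length ts = 2 ^ k" "leaf \<notin> set ts"
  defines "S \<equiv> \<lambda>t. {s \<in> pos t. Q (sub t s)}"
  shows "S (cbt k ts) = (\<Union>i<2 ^ k. (@) (bin k i) ` S (ts ! i))"
  using assms(2,3)
proof (induction k arbitrary: ts)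
  case 0
  then obtain t where "ts = [t]" by (cases ts) auto
  then show ?case by (simp add: lessThan_Suc)
next
  case (Suc k)
  define us vs where "us = take (2 ^ k) ts" and "vs = drop (2 ^ k) ts"
  have len: "length us = 2 ^ k" "length vs = 2 ^ k" using Suc.prems by (simp_all add: us_def vs_def)
  have lf: "leaf \<notin> set us" "leaf \<notin> set vs"
    using Suc.prems(2) unfolding us_def vs_def by (blast dest: in_set_takeD in_set_dropD)+
  have root: "\<not> Q (Node [cbt k us, cbt k vs])"
    using inner cbt_not_leaf len lf by blast
  have "S (Node [A, B]) = (#) 0 ` S A \<union> (#) 1 ` S B" if "\<not> Q (Node [A, B])" for A B
  proof -
    have "p \<in> S (Node [A, B]) \<longleftrightarrow> p \<in> (#) 0 ` S A \<union> (#) 1 ` S B" for p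
      using that by (cases p) (auto simp: S_def Cons_in_pos_pair)
    then show ?thesis by blast
  qed
  from this[OF root] have "S (cbt (Suc k) ts) = (#) 0 ` S (cbt k us) \<union> (#) 1 ` S (cbt k vs)"
    by (simp add: us_def vs_def)
  also have "(#) 0 ` S (cbt k us) = (\<Union>i<2 ^ k. (@) (bin (Suc k) i) ` S (ts ! i))"
    unfolding Suc.IH[OF len(1) lf(1)] image_UN by (rule SUP_cong) (simp_all add: us_def image_image)
  also have "(#) 1 ` S (cbt k vs) = (\<Union>i<2 ^ k. (@) (bin (Suc k) (i + 2 ^ k)) ` S (ts ! (i + 2 ^ k)))"
    unfolding Suc.IH[OF len(2) lf(2)] image_UN
    by (rule SUP_cong) (use Suc.prems(1) in \<open>simp_all add: vs_def image_image add.commute\<close>)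
  also have "\<dots> = (\<Union>i\<in>{2 ^ k..<2 ^ Suc k}. (@) (bin (Suc k) i) ` S (ts ! i))"
  proof -
    have "{2 ^ k..<2 ^ Suc k} = (\<lambda>i. i + 2 ^ k) ` {..<2 ^ k :: nat}"
      unfolding lessThan_atLeast0 image_add_atLeastLessThan' by (simp add: mult_2)
    then show ?thesis by (simp only: image_image)
  qed
  also have "(\<Union>i<2 ^ k. (@) (bin (Suc k) i) ` S (ts ! i)) \<union> \<dots> =
      (\<Union>i\<in>{..<2 ^ k} \<union> {2 ^ k..<2 ^ Suc k}. (@) (bin (Suc k) i) ` S (ts ! i))"
    by (simp only: UN_Un)
  also have "{..<2 ^ k} \<union> {2 ^ k..<2 ^ Suc k} = {..<2 ^ Suc k :: nat}"
    by (rule ivl_disj_un_one) simp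
  finally show ?case .
qed

section \<open>The canonical order on filled trees\<close>

definition canon_less :: "nat list \<Rightarrow> nat list \<Rightarrow> bool" where
  "canon_less p q \<longleftrightarrow> (length p, p) < (length q, q)"

text \<open>A strictly sorted list is determined by its set, so it suffices to exhibit the wanted
  vertices in canonical order.\<close>

lemma filter_vlist:
  assumes "sorted_wrt canon_less ps" "set ps = {p \<in> pos t. Q p}"
  shows "filter Q (vlist t) = ps"
proof -
  let ?f = "\<lambda>p :: nat list. (length p, p)"
  let ?xs = "sorted_list_of_set (?f ` pos t)"
  have set: "set ?xs = ?f ` pos t" by (simp add: finite_pos)
  have "filter (\<lambda>x. Q (snd x)) ?xs = map ?f ps"
  proof (rule strict_sorted_equal)
    show "sorted_wrt (<) (filter (\<lambda>x. Q (snd x)) ?xs)"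
      by (intro sorted_wrt_filter strict_sorted_list_of_set)
    show "set (filter (\<lambda>x. Q (snd x)) ?xs) = set (map ?f ps)"
      using assms(2) set by auto
    show "sorted_wrt (<) (map ?f ps)"
      using assms(1) by (simp add: sorted_wrt_map canon_less_def[abs_def])
  qed
  moreover have "filter Q (vlist t) = map snd (filter (\<lambda>x. Q (snd x)) ?xs)"
    unfolding vlist_def by (simp add: filter_map comp_def)
  ultimately show ?thesis by (simp add: comp_def)
qed

definition block :: "nat \<Rightarrow> nat list list \<Rightarrow> nat \<Rightarrow> nat \<Rightarrow> nat list list" where
  "block k ss a b = concat (map (\<lambda>i. map ((@) (bin k i)) ss) [a..<b])"

lemma set_block: "set (block k ss a b) = (\<Union>i\<in>{a..<b}. (@) (bin k i) ` set ss)"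
  by (auto simp: block_def)

lemma sorted_block:
  assumes "sorted_wrt (<) ss" "\<And>s. s \<in> set ss \<Longrightarrow> length s = l"
  shows "b \<le> 2 ^ k \<Longrightarrow> sorted_wrt canon_less (block k ss a b)"
proof (induction b)
  case 0
  then show ?case by (simp add: block_def)
next
  case (Suc b)
  show ?case
  proof (cases "a \<le> b")
    case True
    have "sorted_wrt canon_less (map ((@) (bin k b)) ss)"
      unfolding sorted_wrt_map
      by (rule sorted_wrt_mono_rel[OF _ assms(1)]) (simp add: canon_less_def assms(2) bin_append_less)
    moreover have "canon_less x y"
      if "x \<in> set (block k ss a b)" "y \<in> set (map ((@) (bin k b)) ss)" for x y
    proof -
      from that obtain i s u where "i < b" "s \<in> set ss" "u \<in> set ss" "x = bin k i @ s" "y = bin k b @ u"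
        by (auto simp: set_block)
      then show ?thesis
        using bin_less[of i b k s u] Suc.prems assms(2) by (simp add: canon_less_def length_bin)
    qed
    ultimately have "sorted_wrt canon_less (block k ss a b @ map ((@) (bin k b)) ss)"
      using Suc unfolding sorted_wrt_append by simp
    then show ?thesis using True by (simp add: block_def)
  next
    case False
    then show ?thesis by (simp add: block_def)
  qed
qed

text \<open>The vertices found in a \<open>B2\<close> lie one level below those found in a
  \<open>star3\<close>. Hence the \<open>star3\<close> blocks come first, although they stand
  further right.\<close>

lemma filter_vlist_fill:
  assumes inner: "\<And>A B. A \<noteq> leaf \<Longrightarrow> B \<noteq> leaf \<Longrightarrow> \<not> Q (Node [A, B])"
    and pq: "p + q = 2 ^ k"
    and ss: "set ss = {s \<in> pos star3. Q (sub star3 s)}" "sorted_wrt (<) ss" "\<And>s. s \<in> set ss \<Longrightarrow> length s = l"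
    and us: "set us = {s \<in> pos B2. Q (sub B2 s)}" "sorted_wrt (<) us" "\<And>s. s \<in> set us \<Longrightarrow> length s = Suc l"
  defines "t \<equiv> cbt k (fill p q)"
  shows "filter (\<lambda>x. Q (sub t x)) (vlist t) = block k ss p (2 ^ k) @ block k us 0 p"
proof (rule filter_vlist)
  have "sorted_wrt canon_less (block k ss p (2 ^ k))"
    using ss(2,3) order.refl by (rule sorted_block)
  moreover have "sorted_wrt canon_less (block k us 0 p)"
    by (rule sorted_block[OF us(2,3)]) (use pq in simp_all)
  moreover have "canon_less x y"
    if "x \<in> set (block k ss p (2 ^ k))" "y \<in> set (block k us 0 p)" for x y
    using that ss(3) us(3) by (auto simp: set_block length_bin canon_less_def)
  ultimately show "sorted_wrt canon_less (block k ss p (2 ^ k) @ block k us 0 p)"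
    unfolding sorted_wrt_append by blast
  have "{x \<in> pos t. Q (sub t x)} =
    (\<Union>i<2 ^ k. (@) (bin k i) ` {s \<in> pos (fill p q ! i). Q (sub (fill p q ! i) s)})"
    unfolding t_def
    by (rule branches_cbt[where Q = Q, OF inner]) (use pq in \<open>auto simp: fill_def leaf_def B2_def star3_def\<close>)
  also have "\<dots> = (\<Union>i\<in>{p..<2 ^ k}. (@) (bin k i) ` set ss) \<union> (\<Union>i\<in>{0..<p}. (@) (bin k i) ` set us)"
  proof -
    have "fill p q ! i = (if i < p then B2 else star3)" if "i < 2 ^ k" for i
      using that pq by (auto simp: fill_def nth_append)
    moreover have "{..<2 ^ k} = {p..<2 ^ k} \<union> {0..<p}" using pq by auto
    ultimately show ?thesis
      unfolding ss(1) us(1) UN_Un[symmetric] using pq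
      by (simp only: UN_Un) (intro arg_cong2[where f = "(\<union>)"] SUP_cong refl; simp)
  qed
  finally show "set (block k ss p (2 ^ k) @ block k us 0 p) = {x \<in> pos t. Q (sub t x)}"
    by (simp add: set_block)
qed

lemma pos_star3: "pos star3 = {[], [0], [1], [2]}"
proof -
  have "p \<in> pos star3 \<longleftrightarrow> p \<in> {[], [0], [1], [2]}" for p
    by (cases p; cases "tl p") (auto simp: pos_def star3_def leaf_def nth_Cons' less_Suc_eq numeral_3_eq_3)
  then show ?thesis by blast
qed

lemma pos_B2: "pos B2 = {[], [0], [1], [0,0], [0,1], [0,2], [1,0], [1,1], [1,2]}"
proof -
  have "[] \<in> pos B2" by (simp add: pos_def)
  then have "p \<in> pos B2 \<longleftrightarrow> p = [] \<or> (\<exists>q\<in>pos star3. p = 0 # q \<or> p = 1 # q)" for p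
    by (cases p) (auto simp: B2_def Cons_in_pos_pair)
  then show ?thesis unfolding pos_star3 by auto
qed

lemma hlc_fill:
  assumes "p + q = 2 ^ k"
  shows "hlc (cbt k (fill p q)) = block k [[]] p (2 ^ k) @ block k [[0], [1]] 0 p"
  unfolding hlc_def has_leaf_child_def
proof (rule filter_vlist_fill[where Q = "\<lambda>t. leaf \<in> set (kids t)", OF _ assms, where l = 0])
  show "set [[]] = {s \<in> pos star3. leaf \<in> set (kids (sub star3 s))}"
    unfolding pos_star3 by (auto simp: star3_def leaf_def)
  show "set [[0], [1]] = {s \<in> pos B2. leaf \<in> set (kids (sub B2 s))}"
    unfolding pos_B2 by (auto simp: B2_def star3_def leaf_def)
qed auto

lemma leaves_fill:
  assumes "p + q = 2 ^ k"
  shows "leaves_c (cbt k (fill p q)) = block k [[0], [1], [2]] p (2 ^ k) @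
    block k [[0,0], [0,1], [0,2], [1,0], [1,1], [1,2]] 0 p"
  unfolding leaves_c_def
proof (rule filter_vlist_fill[where Q = "\<lambda>t. kids t = []", OF _ assms, where l = 1])
  show "set [[0], [1], [2]] = {s \<in> pos star3. kids (sub star3 s) = []}"
    unfolding pos_star3 by (auto simp: star3_def leaf_def)
  show "set [[0,0], [0,1], [0,2], [1,0], [1,1], [1,2]] = {s \<in> pos B2. kids (sub B2 s) = []}"
    unfolding pos_B2 by (auto simp: B2_def star3_def leaf_def)
qed auto

lemma block_Suc: "block k ss 0 (Suc p) = block k ss 0 p @ map ((@) (bin k p)) ss"
  by (simp add: block_def)

lemma block_first: "a < b \<Longrightarrow> block k ss a b = map ((@) (bin k a)) ss @ block k ss (Suc a) b"
  by (simp add: block_def upt_conv_Cons)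

lemma block_empty: "block k ss a a = []"
  by (simp add: block_def)

section \<open>The parameters h and m\<close>

lemma h_of_eq:
  assumes "5 * 2 ^ k + 1 < n" "n \<le> 5 * 2 ^ Suc k + 1"
  shows "h_of n = Suc k"
  unfolding h_of_def
proof (rule the_equality)
  fix h assume h: "5 * 2 ^ (h - 1) + 1 < n \<and> n \<le> 5 * 2 ^ h + 1"
  \<comment> \<open>For \<open>h = 0\<close> the truncated \<open>h - 1\<close> is 0 as well, and
    the bounds read \<open>6 < n\<close> and \<open>n <= 6\<close>.\<close>
  have "h \<noteq> 0" using h by (cases h) auto
  then obtain j where j: "h = Suc j" by (cases h) auto
  then have h': "5 * 2 ^ j + 1 < n" "n \<le> 5 * 2 ^ Suc j + 1" using h by simp_all
  have "(2::nat) ^ j < 2 ^ Suc k" using less_le_trans[OF h'(1) assms(2)] by linarith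
  then have "j < Suc k" by (rule power_less_imp_less_exp[rotated]) simp
  moreover have "(2::nat) ^ k < 2 ^ Suc j" using less_le_trans[OF assms(1) h'(2)] by linarith
  then have "k < Suc j" by (rule power_less_imp_less_exp[rotated]) simp
  ultimately show "h = Suc k" using j by simp
qed (use assms in simp)

lemma m_of_eq:
  assumes "5 * m \<le> n + 3" "n \<le> 5 * m + 1"
  shows "m_of n = m"
proof -
  have 1: "5 * real m \<le> real n + 3" using of_nat_mono[OF assms(1), where 'a = real] by simp
  have 2: "real n \<le> 5 * real m + 1" using of_nat_mono[OF assms(2), where 'a = real] by simp
  have "round ((real n + 1) / 5) = int m"
  proof (rule round_unique)
    show "(real n + 1) / 5 - 1 / 2 < of_int (int m)" using 2 by (simp add: field_simps)
    show "of_int (int m) \<le> (real n + 1) / 5 + 1 / 2" using 1 by (simp add: field_simps)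
  qed
  then show ?thesis by (simp add: m_of_def)
qed

lemma Tn_parameters_exist:
  assumes "6 < n"
  obtains k p where "1 \<le> p" "p \<le> 2 ^ k" "h_of n = Suc k" "m_of n = 2 ^ k + p"
    "5 * (2 ^ k + p) \<le> n + 3" "n \<le> 5 * (2 ^ k + p) + 1"
proof -
  have "n \<le> 5 * 2 ^ Suc n + 1" using less_exp[of n] unfolding power_Suc by linarith
  then have ex: "\<exists>k. n \<le> 5 * 2 ^ Suc k + 1" by blast
  define k where "k = (LEAST k. n \<le> 5 * 2 ^ Suc k + 1)"
  have k: "n \<le> 5 * 2 ^ Suc k + 1" unfolding k_def using ex by (rule LeastI_ex)
  have k': "5 * 2 ^ k + 1 < n"
  proof (cases k)
    case 0
    then show ?thesis using assms by simp
  next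
    case (Suc j)
    then have "\<not> n \<le> 5 * 2 ^ Suc j + 1" using not_less_Least[of j "\<lambda>k. n \<le> 5 * 2 ^ Suc k + 1"] k_def by simp
    then show ?thesis using Suc by simp
  qed
  \<comment> \<open>Rounding \<open>(n + 1) / 5\<close> means taking the floor after adding one
    half, and for an integer \<open>n\<close> this is the floor of
    \<open>(n + 3) / 5\<close>.\<close>
  define m where "m = (n + 3) div 5"
  have "5 * m + (n + 3) mod 5 = n + 3" "(n + 3) mod 5 < 5" by (simp_all add: m_def)
  then have m: "5 * m \<le> n + 3" "n \<le> 5 * m + 1" by linarith+
  have lt: "2 ^ k < m" using k' m(2) by linarith
  have "m \<le> 2 * 2 ^ k"
  proof (rule ccontr)
    assume "\<not> m \<le> 2 * 2 ^ k"
    then have "2 * 2 ^ k + 1 \<le> m" by simp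
    then show False using k m(1) unfolding power_Suc by linarith
  qed
  then show thesis
    using that[of "m - 2 ^ k" k] h_of_eq[OF k' k] m_of_eq[OF m] m lt by simp
qed

lemma list_update_fill: "(fill (Suc p) q)[p := x] = fill_minus x (Suc p) q"
proof -
  have "fill (Suc p) q = replicate p B2 @ B2 # replicate q star3"
    by (simp add: fill_def replicate_app_Cons_same)
  then show ?thesis using list_update_length[of "replicate p B2"] by (simp add: fill_minus_def)
qed

lemma del_leaf_star3: "del_leaf star3 = star2"
  by (simp add: del_leaf_def star3_def)

lemma add_leaf_star3: "add_leaf star3 = star4"
  by (simp add: add_leaf_def star3_def)

lemma upd_at_pair:
  "upd_at [0] f (Node [A, B]) = Node [f A, B]" "upd_at [1] f (Node [A, B]) = Node [A, f B]"
  by simp_all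

text \<open>\<open>k\<close> is the height of the complete binary tree, \<open>p\<close> the number
  of its \<open>B2\<close> blocks and \<open>q\<close> that of its \<open>star3\<close>
  blocks.\<close>

locale Tn_parameters =
  fixes n k p q :: nat
  assumes h: "h_of n = Suc k" and m: "m_of n = 2 ^ k + p" and pq: "p + q = 2 ^ k" and p_pos: "0 < p"
begin

abbreviation base :: tree where "base \<equiv> cbt k (fill p q)"

lemma base_tree: "base_tree n = base"
proof -
  have "2 ^ Suc k - (2 ^ k + p) = q" by (simp flip: pq)
  then show ?thesis unfolding base_tree_def Let_def h m by (simp add: fill_def)
qed

lemma upd_B2: "i < p \<Longrightarrow> upd_at (bin k i @ s) f base = cbt k ((fill p q)[i := upd_at s f B2])"
  using pq by (simp add: upd_at_cbt length_fill) (simp add: fill_def nth_append)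

lemma upd_star3: "p \<le> i \<Longrightarrow> i < 2 ^ k \<Longrightarrow> upd_at (bin k i) f base = cbt k ((fill p q)[i := f star3])"
  using upd_at_cbt[of "fill p q" k i "[]" f] pq by (simp add: length_fill) (simp add: fill_def nth_append)

lemma Tn_cases:
  "n + 1 = 5 * (2 ^ k + p) \<Longrightarrow> Tn n = base"
  "n + 2 = 5 * (2 ^ k + p) \<Longrightarrow> Tn n = remove_leaf_at (last (leaves_c base)) base"
  "n + 3 = 5 * (2 ^ k + p) \<Longrightarrow>
    Tn n = upd_at (hlc base ! (length (hlc base) - 2)) del_leaf (upd_at (last (hlc base)) del_leaf base)"
  "n = 5 * (2 ^ k + p) \<Longrightarrow> Tn n = upd_at (hd (hlc base)) add_leaf base"
  "n = 5 * (2 ^ k + p) + 1 \<Longrightarrow> Tn n = upd_at (hlc base ! 1) add_leaf (upd_at (hlc base ! 0) add_leaf base)"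
proof -
  \<comment> \<open>Stated for arbitrary trees, so that simplification only decides the numerical
    conditions.\<close>
  have select:
    "n + 1 = 5 * M \<Longrightarrow> U = A"
    "n + 2 = 5 * M \<Longrightarrow> U = B"
    "n + 3 = 5 * M \<Longrightarrow> U = C"
    "n = 5 * M \<Longrightarrow> U = D"
    "n = 5 * M + 1 \<Longrightarrow> U = E"
    if "U = (if n + 1 = 5 * M then A else if n + 2 = 5 * M then B
      else if n + 3 = 5 * M then C else if n = 5 * M then D else E)"
    for n M :: nat and U A B C D E :: tree
    unfolding that by simp_all
  note T = Tn_def[of n, unfolded Let_def m base_tree]
  show "n + 1 = 5 * (2 ^ k + p) \<Longrightarrow> Tn n = base" using T by (rule select(1))
  show "n + 2 = 5 * (2 ^ k + p) \<Longrightarrow> Tn n = remove_leaf_at (last (leaves_c base)) base"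
    using T by (rule select(2))
  show "n + 3 = 5 * (2 ^ k + p) \<Longrightarrow>
      Tn n = upd_at (hlc base ! (length (hlc base) - 2)) del_leaf (upd_at (last (hlc base)) del_leaf base)"
    using T by (rule select(3))
  show "n = 5 * (2 ^ k + p) \<Longrightarrow> Tn n = upd_at (hd (hlc base)) add_leaf base"
    using T by (rule select(4))
  show "n = 5 * (2 ^ k + p) + 1 \<Longrightarrow> Tn n = upd_at (hlc base ! 1) add_leaf (upd_at (hlc base ! 0) add_leaf base)"
    using T by (rule select(5))
qed

lemma Tn_minus:
  assumes "n + 2 = 5 * (2 ^ k + p)"
  shows "Tn n = cbt k (fill_minus B2_minus p q)"
proof -
  obtain r where r: "p = Suc r" using p_pos by (cases p) auto
  \<comment> \<open>The deepest level belongs to the \<open>B2\<close> blocks, so the last leaf is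
    the third leaf of the second star in the last of them.\<close>
  have "last (leaves_c base) = (bin k r @ [1]) @ [2]"
    unfolding leaves_fill[OF pq] by (simp add: r block_Suc)
  then have "Tn n = remove_leaf_at ((bin k r @ [1]) @ [2]) base"
    unfolding Tn_cases(2)[OF assms] by simp
  also have "\<dots> = cbt k ((fill p q)[r := B2_minus])"
    unfolding remove_leaf_at_def butlast_snoc last_snoc
    by (subst upd_B2) (simp_all add: r B2_def star3_def)
  finally show ?thesis unfolding r list_update_fill .
qed

lemma Tn_minus2:
  assumes "n + 3 = 5 * (2 ^ k + p)"
  shows "Tn n = cbt k (fill_minus B4 p q)"
proof -
  obtain r where r: "p = Suc r" using p_pos by (cases p) auto
  \<comment> \<open>The last two parents of leaves are the two stars of the last \<open>B2\<close>;
    losing one leaf each, they turn it into \<open>B4\<close>.\<close>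
  have "last (hlc base) = bin k r @ [1]" "hlc base ! (length (hlc base) - 2) = bin k r @ [0]"
    unfolding hlc_fill[OF pq] by (simp_all add: r block_Suc nth_append)
  then have "Tn n = upd_at (bin k r @ [0]) del_leaf (upd_at (bin k r @ [1]) del_leaf base)"
    unfolding Tn_cases(3)[OF assms] by simp
  also have "upd_at (bin k r @ [1]) del_leaf base = cbt k ((fill p q)[r := B2_minus])"
    unfolding upd_B2[of r, unfolded r, OF lessI] B2_def upd_at_pair del_leaf_star3 r ..
  also have "upd_at (bin k r @ [0]) del_leaf (cbt k ((fill p q)[r := B2_minus])) = cbt k ((fill p q)[r := B4])"
  proof -
    have "r < 2 ^ k" "r < length (fill p q)" using pq r by (simp_all add: length_fill)
    then show ?thesis
      using upd_at_cbt[of "(fill p q)[r := B2_minus]" k r "[0]" del_leaf] pq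
      by (simp add: length_fill del_leaf_star3 B4_def)
  qed
  finally show ?thesis unfolding r list_update_fill .
qed

lemma Tn_plus:
  assumes "n = 5 * (2 ^ k + p)"
  shows "Tn n = cbt k (fill_plus p q)"
proof -
  note T = Tn_cases(4)[OF assms]
  show ?thesis
  proof (cases q)
    case 0
    then have "hd (hlc base) = bin k 0 @ [0]"
      unfolding hlc_fill[OF pq] using pq p_pos by (simp add: block_empty block_first)
    then have "Tn n = cbt k ((fill p q)[0 := B2_plus])"
      unfolding T using upd_B2[OF p_pos, of "[0]" add_leaf]
      unfolding B2_def upd_at_pair add_leaf_star3 by simp
    also have "(fill p q)[0 := B2_plus] = fill_plus p q"
      using p_pos 0 by (cases p) (simp_all add: fill_def fill_plus_def)
    finally show ?thesis .
  next
    case (Suc r)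
    then have "hd (hlc base) = bin k p"
      unfolding hlc_fill[OF pq] using pq by (simp add: block_first)
    moreover have "p < 2 ^ k" using pq Suc by simp
    ultimately have "Tn n = cbt k ((fill p q)[p := star4])"
      unfolding T using upd_star3[of p add_leaf] by (simp add: add_leaf_star3)
    also have "(fill p q)[p := star4] = fill_plus p q"
      using Suc by (simp add: fill_def fill_plus_def list_update_append)
    finally show ?thesis .
  qed
qed

lemma Tn_plus2:
  assumes "n = 5 * (2 ^ k + p) + 1"
  shows "Tn n = cbt k (fill_plus2 p q)"
proof -
  note T = Tn_cases(5)[OF assms]
  consider "q = 0" | "q = 1" | r where "q = Suc (Suc r)" by (cases q; cases "q - 1") auto
  then show ?thesis
  proof cases
    case 1
    then have hlc: "hlc base ! 0 = bin k 0 @ [0]" "hlc base ! 1 = bin k 0 @ [1]"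
      unfolding hlc_fill[OF pq] using pq p_pos by (simp_all add: block_empty block_first)
    have "upd_at (bin k 0 @ [0]) add_leaf base = cbt k ((fill p q)[0 := B2_plus])"
      using upd_B2[OF p_pos, of "[0]" add_leaf] unfolding B2_def upd_at_pair add_leaf_star3 by simp
    moreover have "upd_at (bin k 0 @ [1]) add_leaf (cbt k ((fill p q)[0 := B2_plus])) =
        cbt k ((fill p q)[0 := B2_plus2])"
    proof -
      have "0 < length (fill p q)" using p_pos by (simp add: length_fill)
      then show ?thesis
        using upd_at_cbt[of "(fill p q)[0 := B2_plus]" k 0 "[1]" add_leaf] pq
        by (simp add: length_fill add_leaf_star3)
    qed
    ultimately have "Tn n = cbt k ((fill p q)[0 := B2_plus2])" unfolding T hlc by simp
    also have "(fill p q)[0 := B2_plus2] = fill_plus2 p q"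
      using p_pos 1 by (cases p) (simp_all add: fill_def fill_plus2_def)
    finally show ?thesis .
  next
    case 2
    \<comment> \<open>After the only \<open>star3\<close> the canonical order continues on the next
      level, with the first star of the leftmost \<open>B2\<close>.\<close>
    then have hlc: "hlc base ! 0 = bin k p" "hlc base ! 1 = bin k 0 @ [0]"
      unfolding hlc_fill[OF pq] using pq p_pos by (simp_all add: block_empty block_first)
    have "p < 2 ^ k" using pq 2 by simp
    then have "upd_at (bin k p) add_leaf base = cbt k ((fill p q)[p := star4])"
      using upd_star3[of p add_leaf] by (simp add: add_leaf_star3)
    moreover have "(fill p q)[p := star4] = replicate p B2 @ [star4]"
      using 2 by (simp add: fill_def list_update_append)
    moreover have "upd_at (bin k 0 @ [0]) add_leaf (cbt k (replicate p B2 @ [star4])) =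
        cbt k ((replicate p B2 @ [star4])[0 := B2_plus])"
    proof -
      have "(replicate p B2 @ [star4]) ! 0 = B2" using p_pos by (simp add: nth_append)
      then show ?thesis
        using upd_at_cbt[of "replicate p B2 @ [star4]" k 0 "[0]" add_leaf] pq 2
        by (simp add: B2_def add_leaf_star3)
    qed
    ultimately have "Tn n = cbt k ((replicate p B2 @ [star4])[0 := B2_plus])"
      unfolding T hlc by simp
    also have "(replicate p B2 @ [star4])[0 := B2_plus] = fill_plus2 p q"
      using p_pos 2 by (cases p) (simp_all add: fill_plus2_def)
    finally show ?thesis .
  next
    case (3 r)
    then have hlc: "hlc base ! 0 = bin k p" "hlc base ! 1 = bin k (Suc p) @ []"
      unfolding hlc_fill[OF pq] using pq by (simp_all add: block_first)
    have "p < 2 ^ k" using pq 3 by simp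
    then have "upd_at (bin k p) add_leaf base = cbt k ((fill p q)[p := star4])"
      using upd_star3[of p add_leaf] by (simp add: add_leaf_star3)
    moreover have "(fill p q)[p := star4] = replicate p B2 @ star4 # star3 # replicate r star3"
      using 3 by (simp add: fill_def list_update_append)
    moreover have "upd_at (bin k (Suc p) @ []) add_leaf (cbt k (replicate p B2 @ star4 # star3 # replicate r star3)) =
        cbt k ((replicate p B2 @ star4 # star3 # replicate r star3)[Suc p := star4])"
    proof -
      have "(replicate p B2 @ star4 # star3 # replicate r star3) ! Suc p = star3" by (simp add: nth_append)
      moreover have "Suc p < 2 ^ k" "p + Suc (Suc r) = 2 ^ k" using pq 3 by simp_all
      ultimately show ?thesis
        using upd_at_cbt[of "replicate p B2 @ star4 # star3 # replicate r star3" k "Suc p" "[]" add_leaf]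
        by (simp add: add_leaf_star3)
    qed
    ultimately have "Tn n = cbt k ((replicate p B2 @ star4 # star3 # replicate r star3)[Suc p := star4])"
      unfolding T hlc by simp
    also have "(replicate p B2 @ star4 # star3 # replicate r star3)[Suc p := star4] = fill_plus2 p q"
      using 3 by (simp add: fill_plus2_def list_update_append)
    finally show ?thesis .
  qed
qed

lemma canon_Tn:
  assumes "5 * (2 ^ k + p) \<le> n + 3" "n \<le> 5 * (2 ^ k + p) + 1"
  shows "canon n (Tn n)"
proof -
  have q: "q = 2 ^ k - p" and p: "p \<le> 2 ^ k" "1 \<le> p" using p_pos by (simp_all flip: pq)
  consider "n + 1 = 5 * (2 ^ k + p)" | "n + 2 = 5 * (2 ^ k + p)" | "n + 3 = 5 * (2 ^ k + p)"
    | "n = 5 * (2 ^ k + p)" | "n = 5 * (2 ^ k + p) + 1"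
    using assms by linarith
  then show ?thesis
  proof cases
    case 1
    then show ?thesis unfolding Tn_cases(1)[OF 1] q by (rule canon_fill[OF p(1)])
  next
    case 2
    show ?thesis unfolding Tn_minus[OF 2] q by (rule canon_fill_minus[OF _ p(2,1) 2]) simp
  next
    case 3
    show ?thesis unfolding Tn_minus2[OF 3] q by (rule canon_fill_minus[OF _ p(2,1) 3]) simp
  next
    case 4
    then show ?thesis unfolding Tn_plus[OF 4] q by (rule canon_fill_plus[OF p(1)])
  next
    case 5
    have "1 \<le> (2::nat) ^ k" by simp
    then have "2 \<le> 2 ^ k + p" using p(2) by linarith
    show ?thesis unfolding Tn_plus2[OF 5] q using \<open>2 \<le> 2 ^ k + p\<close> by (rule canon_fill_plus2[OF p(1) _ 5])
  qed
qed

end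

lemma canon_Tn:
  assumes "6 < n"
  shows "canon n (Tn n)"
proof -
  obtain k p where p: "1 \<le> p" "p \<le> 2 ^ k" "h_of n = Suc k" "m_of n = 2 ^ k + p"
    "5 * (2 ^ k + p) \<le> n + 3" "n \<le> 5 * (2 ^ k + p) + 1"
    using Tn_parameters_exist[OF assms] .
  interpret Tn_parameters n k p "2 ^ k - p" by unfold_locales (use p in simp_all)
  show ?thesis using p(5,6) by (rule canon_Tn)
qed

theorem theorem4p3:
  fixes n :: nat
  assumes "n > 6"
  shows "order (Tn n) = n \<and> minimal (Tn n) \<and>
    (n mod 5 \<noteq> 2 \<longrightarrow> (\<forall>T. order T = n \<and> minimal T \<longrightarrow> iso T (Tn n))) \<and>
    (n mod 5 = 2 \<longrightarrow>
      (\<exists>p. p \<in> pos (Tn n) \<and> iso (sub (Tn n) p) B4 \<and>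
           (\<forall>q\<in>pos (Tn n). iso (sub (Tn n) q) B4 \<longrightarrow> q = p) \<and>
           (\<forall>T. order T = n \<longrightarrow>
              (minimal T \<longleftrightarrow> iso T (Tn n) \<or> iso T (upd_at p (\<lambda>_. B4') (Tn n))))))"
  by (rule canon_characterisation[OF canon_Tn[OF assms]])

end
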